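(* Let $h\in L^{+}$ and let $(n_k)_{k\ge0}$ be a strictly increasing sequence of non-negative integers. The following are equivalent: (i) for every entire function $f\in\mathcal{E}$ of the form $f(z)=\sum_{k=0}^{+\infty}f_kz^{n_k}$ there is a set $E\subset[1,+\infty)$ of finite $h$-log-measure such that $$M_f(r)=(1+o(1))\,m_f(r),\qquad M_f(r)=(1+o(1))\,\mu_f(r)$$ as $r\to+\infty$, $r\notin E$; (ii) $$(\forall b>0):\quad \sum_{k=0}^{+\infty}\frac{1}{n_{k+1}-n_k}\,h'\big((n_k)^b\big)<+\infty.$$
   Context: $L^{+}$ is the class of positive, differentiable functions on $[0,+\infty)$ increasing to $+\infty$ with non-decreasing derivative. For an entire function $f(z)=\sum_{k=0}^{+\infty}f_kz^{n_k}$ and $r>0$: $M_f(r)=\max\{|f(z)|:|z|=r\}$, $m_f(r)=\min\{|f(z)|:|z|=r\}$, $\mu_f(r)=\max\{|f_k|r^{n_k}:k\ge0\}$. $\mathcal{E}$ is the class of entire functions of positive lower order, i.e. with $\lambda_f:=\liminf_{r\to+\infty}\frac{\ln\ln M_f(r)}{\ln r}>0$. The $h$-log-measure of a measurable set $E\subset[1,+\infty)$ is $\int_E\frac{dh(r)}{r}$. *)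

theory Defs
  imports "HOL-Analysis.Analysis" "HOL-Library.Landau_Symbols"
begin

text \<open>Derivative of a function given on the half-line \<open>[0,\<infinity>)\<close>; at \<open>0\<close> it is the right derivative.
  Values of \<open>h\<close> at negative arguments never matter.\<close>

definition half_line_deriv :: "(real \<Rightarrow> real) \<Rightarrow> real \<Rightarrow> real" where
  "half_line_deriv h x = vector_derivative h (at x within {0..})"

definition L_plus :: "(real \<Rightarrow> real) set" where
  "L_plus = {h. (\<forall>x\<ge>0. 0 < h x) \<and> h differentiable_on {0..} \<and>
     strict_mono_on {0..} h \<and> filterlim h at_top at_top \<and>
     mono_on {0..} (half_line_deriv h)}"

text \<open>The integral of \<open>dh(r) / r\<close> over \<open>E\<close>, with \<open>dh\<close> the Lebesgue-Stieltjes (Borel) measure of \<open>h\<close>.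
  Since \<^const>\<open>interval_measure\<close> expects a monotone right-continuous function on the whole line,
  \<open>h\<close> is extended by the constant \<open>h 0\<close> to the left.\<close>

definition h_log_measure :: "(real \<Rightarrow> real) \<Rightarrow> real set \<Rightarrow> ennreal" where
  "h_log_measure h E = (\<integral>\<^sup>+ r\<in>E. ennreal (1 / r) \<partial>interval_measure (\<lambda>x. h (max 0 x)))"

definition max_modulus :: "(complex \<Rightarrow> complex) \<Rightarrow> real \<Rightarrow> real" where
  "max_modulus f r = (SUP z\<in>sphere 0 r. cmod (f z))"

definition min_modulus :: "(complex \<Rightarrow> complex) \<Rightarrow> real \<Rightarrow> real" where
  "min_modulus f r = (INF z\<in>sphere 0 r. cmod (f z))"

text \<open>The maximal term of the series with terms \<open>a k * z ^ n k\<close>.\<close>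

definition max_term :: "(nat \<Rightarrow> complex) \<Rightarrow> (nat \<Rightarrow> nat) \<Rightarrow> real \<Rightarrow> real" where
  "max_term a n r = (SUP k. cmod (a k) * r ^ n k)"

definition lower_order :: "(complex \<Rightarrow> complex) \<Rightarrow> ereal" where
  "lower_order f = Liminf at_top (\<lambda>r. ereal (ln (ln (max_modulus f r)) / ln r))"

definition entire_pos_lower_order :: "(complex \<Rightarrow> complex) set" where
  "entire_pos_lower_order = {f. f holomorphic_on UNIV \<and> 0 < lower_order f}"

end

theory Submission
  imports Defs "HOL-Complex_Analysis.Conformal_Mappings" "HOL-Real_Asymp.Real_Asymp"
begin

text \<open>
Write \<open>g k = n (Suc k) - n k\<close> for the gaps. Both directions rest on one picture: as \<open>r\<close> grows, the
index of the largest term \<open>cmod (a k) * r ^ n k\<close> jumps upwards, and close to the radius where the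
lead passes from one term to the next the two terms are comparable, so that neither of them
carries the function alone. A jump across the gap \<open>g k\<close> is felt on an interval of logarithmic length
about \<open>1 / g k\<close>. For a function of positive lower order the radius of that jump is at most a power of
\<open>n k\<close>, and since \<open>h'\<close> is monotone, the interval has \<open>h\<close>-log-measure at most about
\<open>h' (n k powr b) / g k\<close>.

To see that convergence suffices, choose weights \<open>c k\<close> tending to infinity so slowly that the series still
converges after multiplication by \<open>c k\<close> (\<open>summable_slow_weights\<close>), let \<open>\<tau>\<close> be the partial sums of
\<open>\<delta> k = 2 * c k / g k\<close>, and multiply the coefficients by \<open>exp (T k)\<close>, where \<open>T\<close> is the convex function of
\<open>n k\<close> whose slope on the \<open>k\<close>-th gap is the midpoint of \<open>\<tau> k\<close> and \<open>\<tau> (Suc k)\<close>. If the modified series has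
central index \<open>v\<close> at \<open>r * exp (- \<tau> v)\<close>, then at \<open>r\<close> the \<open>v\<close>-th term of the original series beats every
other one by the distance between \<open>T\<close> and a supporting line, and this distance grows like the sum of
the weights \<open>c\<close> in between (\<open>convex_weights_above_tangent\<close>); hence a single term carries the function.
Only radii in intervals of logarithmic length \<open>\<delta> k\<close>, one for each \<open>k\<close>, are not of this form
(\<open>normal_values\<close>). Positive lower order bounds the position of the \<open>k\<close>-th interval by a power of
\<open>n k\<close> (\<open>central_index_lower_bound\<close>), so these intervals have finite total \<open>h\<close>-log-measure.

To see that it is necessary, note that a series with positive coefficients can be built with prescribed jump
radii \<open>\<rho> k\<close>; it has positive lower order when \<open>\<rho> k\<close> is bounded by a power of \<open>n k\<close>
(\<open>breakpoint_series\<close>), and right after \<open>\<rho> k\<close>, on an interval of logarithmic length \<open>1 / g k\<close> that may be cut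
short by the next jump, its maximum modulus is at least \<open>1 + exp (- 1)\<close> times its maximal term. The intervals should be disjoint, or else
fill a half-line. With \<open>\<sigma>\<close> the partial sums of \<open>1 / g k\<close>: if \<open>\<sigma>\<close> is unbounded, \<open>\<rho> k = 1 + \<sigma> k\<close> makes
them cover \<open>[1, \<infinity>)\<close>, which has infinite \<open>h\<close>-log-measure because \<open>h'\<close> stays away from \<open>0\<close>. If \<open>\<sigma>\<close> is bounded,
\<open>\<rho> k = (n k + 1) powr b * exp (\<sigma> k)\<close> makes them disjoint while \<open>\<rho> k\<close> keeps the order of magnitude
\<open>n k powr b\<close>, and their total \<open>h\<close>-log-measure dominates the divergent series.
\<close>

section \<open>Functions in the class and the measure they induce\<close>

lemma L_plus_has_deriv:
  assumes "h \<in> L_plus" "0 \<le> x"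
  shows "(h has_real_derivative half_line_deriv h x) (at x within {0..})"
proof -
  have "h differentiable (at x within {0..})"
    using assms by (auto simp: L_plus_def differentiable_on_def)
  then have "(h has_vector_derivative half_line_deriv h x) (at x within {0..})"
    unfolding half_line_deriv_def by (simp add: vector_derivative_works)
  then show ?thesis
    by (simp add: has_real_derivative_iff_has_vector_derivative)
qed

lemma L_plus_mono:
  assumes "h \<in> L_plus" "0 \<le> x" "x \<le> y"
  shows "h x \<le> h y"
  using assms strict_mono_on_imp_mono_on[of "{0..}" h]
  by (auto simp: L_plus_def mono_on_def)

lemma L_plus_deriv_mono:
  assumes "h \<in> L_plus" "0 \<le> x" "x \<le> y"
  shows "half_line_deriv h x \<le> half_line_deriv h y"
  using assms by (auto simp: L_plus_def mono_on_def)

lemma L_plus_mean_value: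
  assumes "h \<in> L_plus" "0 \<le> x" "x < y"
  shows "\<exists>\<xi>\<in>{x<..<y}. h y - h x = half_line_deriv h \<xi> * (y - x)"
proof -
  have "\<exists>\<xi>\<in>{x<..<y}. h y - h x = (*) (half_line_deriv h \<xi>) (y - x)"
  proof (rule mvt_simple[OF assms(3)])
    fix t assume "x \<le> t" "t \<le> y"
    then have "(h has_real_derivative half_line_deriv h t) (at t within {x..y})"
      using assms(2) by (intro DERIV_subset[OF L_plus_has_deriv[OF assms(1), of t]]) auto
    then show "(h has_derivative (*) (half_line_deriv h t)) (at t within {x..y})"
      by (simp add: has_field_derivative_def)
  qed
  then show ?thesis by simp
qed

text \<open>Monotonicity of the derivative turns the mean value theorem into two-sided bounds with the
  derivative at the endpoints, which is all that the estimates of the measure use.\<close>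

lemma L_plus_increment_le:
  assumes "h \<in> L_plus" "0 \<le> x" "x \<le> y"
  shows "h y - h x \<le> half_line_deriv h y * (y - x)"
proof (cases "x = y")
  case False
  then obtain t where "t \<in> {x<..<y}" and eq: "h y - h x = half_line_deriv h t * (y - x)"
    using L_plus_mean_value[of h x y] assms by auto
  then show ?thesis
    unfolding eq using assms by (intro mult_right_mono L_plus_deriv_mono) auto
qed auto

lemma L_plus_increment_ge:
  assumes "h \<in> L_plus" "0 \<le> x" "x \<le> y"
  shows "half_line_deriv h x * (y - x) \<le> h y - h x"
proof (cases "x = y")
  case False
  then obtain t where "t \<in> {x<..<y}" and eq: "h y - h x = half_line_deriv h t * (y - x)"
    using L_plus_mean_value[of h x y] assms by auto
  then show ?thesis
    unfolding eq using assms by (intro mult_right_mono L_plus_deriv_mono) auto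
qed auto

text \<open>Strictness comes from \<open>h 0 < h x\<close>: the mean slope on \<open>[0, x]\<close> is positive and is at most the slope
  at the right end.\<close>

lemma L_plus_deriv_pos:
  assumes "h \<in> L_plus" "0 < x"
  shows "0 < half_line_deriv h x"
proof -
  have "h 0 < h x"
    using assms by (auto simp: L_plus_def strict_mono_on_def)
  moreover have "h x - h 0 \<le> half_line_deriv h x * x"
    using L_plus_increment_le[of h 0 x] assms by simp
  ultimately have "0 < half_line_deriv h x * x" by linarith
  then show ?thesis
    using assms(2) by (simp add: zero_less_mult_iff)
qed

lemma L_plus_deriv_nonneg:
  assumes "h \<in> L_plus" "0 \<le> x"
  shows "0 \<le> half_line_deriv h x"
proof (cases "x = 0")
  case True
  have "((\<lambda>y. (h y - h 0) / (y - 0)) \<longlongrightarrow> half_line_deriv h 0) (at 0 within {0..})"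
    using L_plus_has_deriv[OF assms(1), of 0] by (simp add: has_field_derivative_iff)
  moreover have "\<forall>\<^sub>F y in at 0 within {0..}. 0 \<le> (h y - h 0) / (y - 0)"
    using L_plus_mono[OF assms(1), of 0]
    by (auto simp: eventually_at_filter intro!: always_eventually divide_nonneg_nonneg)
  moreover have "at (0::real) within {0..} \<noteq> bot"
    by (simp add: at_within_Ici_at_right)
  ultimately show ?thesis
    using True tendsto_lowerbound by blast
qed (use L_plus_deriv_pos[OF assms(1), of x] assms in auto)

text \<open>The measure behind \<^const>\<open>h_log_measure\<close> is generated by \<open>h\<close> extended to the left of \<open>0\<close> by a
  constant; on the half-line it assigns to an interval the increment of \<open>h\<close>.\<close>

lemma clamped_mono:
  assumes "h \<in> L_plus" "x \<le> y"
  shows "h (max 0 x) \<le> h (max 0 y)"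
  using L_plus_mono[OF assms(1), of "max 0 x" "max 0 y"] assms(2) by auto

lemma clamped_continuous:
  assumes "h \<in> L_plus"
  shows "continuous_on UNIV (\<lambda>x. h (max 0 x))"
proof -
  have "continuous_on {0..} h"
    using assms by (auto simp: L_plus_def intro: differentiable_imp_continuous_on)
  then have "continuous_on UNIV (h \<circ> max 0)"
    by (intro continuous_on_compose continuous_intros)
       (auto elim!: continuous_on_subset)
  then show ?thesis by (simp add: o_def)
qed

lemma emeasure_clamped_Icc:
  assumes "h \<in> L_plus" "0 \<le> x" "x \<le> y"
  shows "emeasure (interval_measure (\<lambda>x. h (max 0 x))) {x..y} = ennreal (h y - h x)"
  using emeasure_interval_measure_Icc[of x y "\<lambda>x. h (max 0 x)"] assms
    clamped_mono[OF assms(1)] clamped_continuous[OF assms(1)] by simp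

lemma h_log_measure_mono:
  assumes "A \<subseteq> B"
  shows "h_log_measure h A \<le> h_log_measure h B"
  unfolding h_log_measure_def
  by (intro nn_integral_mono mult_left_mono) (use assms in \<open>auto simp: indicator_def\<close>)

lemma h_log_measure_UN_le:
  assumes "\<And>k::nat. A k \<in> sets borel"
  shows "h_log_measure h (\<Union>k. A k) \<le> (\<Sum>k. h_log_measure h (A k))"
proof -
  have *: "indicator (\<Union>k. A k) r \<le> (\<Sum>k. indicator (A k) r :: ennreal)" for r
  proof (cases "r \<in> (\<Union>k. A k)")
    case True
    then obtain k where "r \<in> A k" by auto
    then have "(1::ennreal) \<le> (\<Sum>i\<in>{k}. indicator (A i) r)" by simp
    also have "\<dots> \<le> (\<Sum>i. indicator (A i) r)"
      by (rule sum_le_suminf) auto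
    finally show ?thesis using True by (simp add: indicator_def)
  qed (auto simp: indicator_def)
  have "h_log_measure h (\<Union>k. A k) \<le>
      (\<integral>\<^sup>+ r. (\<Sum>k. ennreal (1 / r) * indicator (A k) r) \<partial>interval_measure (\<lambda>x. h (max 0 x)))"
    unfolding h_log_measure_def
    by (intro nn_integral_mono) (simp add: mult_left_mono *)
  also have "\<dots> = (\<Sum>k. h_log_measure h (A k))"
    unfolding h_log_measure_def using assms
    by (intro nn_integral_suminf) auto
  finally show ?thesis .
qed

lemma h_log_measure_disjoint_UN:
  assumes "\<And>k::nat. A k \<in> sets borel" "disjoint_family A"
  shows "h_log_measure h (\<Union>k. A k) = (\<Sum>k. h_log_measure h (A k))"
proof -
  have "h_log_measure h (\<Union>k. A k) =
      (\<integral>\<^sup>+ r. (\<Sum>k. ennreal (1 / r) * indicator (A k) r) \<partial>interval_measure (\<lambda>x. h (max 0 x)))"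
    unfolding h_log_measure_def
    by (simp add: suminf_indicator[OF assms(2)])
  also have "\<dots> = (\<Sum>k. h_log_measure h (A k))"
    unfolding h_log_measure_def using assms
    by (intro nn_integral_suminf) auto
  finally show ?thesis .
qed

lemma h_log_measure_Icc_le:
  assumes "h \<in> L_plus" "0 < x" "x \<le> y"
  shows "h_log_measure h {x..y} \<le> ennreal (half_line_deriv h y * (y - x) / x)"
proof -
  have "h_log_measure h {x..y} \<le>
      (\<integral>\<^sup>+ r. ennreal (1 / x) * indicator {x..y} r \<partial>interval_measure (\<lambda>x. h (max 0 x)))"
    unfolding h_log_measure_def using assms(2)
    by (intro nn_integral_mono) (auto simp: indicator_def intro!: ennreal_leI divide_left_mono)
  also have "\<dots> = ennreal (1 / x) * ennreal (h y - h x)"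
    using assms by (subst nn_integral_cmult_indicator) (auto simp: emeasure_clamped_Icc)
  also have "\<dots> = ennreal ((h y - h x) / x)"
    using assms L_plus_mono[OF assms(1), of x y] by (simp add: ennreal_mult'[symmetric])
  also have "\<dots> \<le> ennreal (half_line_deriv h y * (y - x) / x)"
    using assms L_plus_increment_le[OF assms(1), of x y]
    by (intro ennreal_leI divide_right_mono) auto
  finally show ?thesis .
qed

text \<open>The half-open shape keeps intervals with a common endpoint disjoint.\<close>

lemma h_log_measure_Ioc_ge:
  assumes "h \<in> L_plus" "0 < x" "x \<le> y"
  shows "ennreal (half_line_deriv h x * (1 - x / y)) \<le> h_log_measure h {x<..y}"
proof -
  have pos: "0 < y" using assms by linarith
  have "half_line_deriv h x * (1 - x / y) = half_line_deriv h x * (y - x) / y"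
    using pos by (simp add: field_simps)
  also have "ennreal \<dots> \<le> ennreal ((h y - h x) / y)"
    using assms pos L_plus_increment_ge[OF assms(1), of x y]
    by (intro ennreal_leI divide_right_mono) auto
  also have "\<dots> = ennreal (1 / y) * ennreal (h y - h x)"
    using assms pos L_plus_mono[OF assms(1), of x y] by (simp add: ennreal_mult'[symmetric])
  also have "ennreal (h y - h x) = emeasure (interval_measure (\<lambda>x. h (max 0 x))) {x<..y}"
    using assms clamped_mono[OF assms(1)]
    by (subst emeasure_interval_measure_Ioc)
       (auto intro!: continuous_on_imp_continuous_within[OF clamped_continuous[OF assms(1)]])
  also have "ennreal (1 / y) * \<dots> =
      (\<integral>\<^sup>+ r. ennreal (1 / y) * indicator {x<..y} r \<partial>interval_measure (\<lambda>x. h (max 0 x)))"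
    by (subst nn_integral_cmult_indicator) auto
  also have "\<dots> \<le> h_log_measure h {x<..y}"
    unfolding h_log_measure_def using assms
    by (intro nn_integral_mono) (auto simp: indicator_def intro!: ennreal_leI divide_left_mono)
  finally show ?thesis .
qed

lemma h_log_measure_chain_infinite:
  assumes "h \<in> L_plus"
    and pos: "\<And>k::nat. 0 < x k"
    and chain: "\<And>k. x k \<le> y k" "\<And>k. y k \<le> x (Suc k)"
    and div: "\<not> summable (\<lambda>k. half_line_deriv h (x k) * (1 - x k / y k))"
  shows "h_log_measure h (\<Union>k. {x k<..y k}) = \<infinity>"
proof -
  have "incseq x" using chain by (intro incseq_SucI) (meson order_trans)
  then have dj: "{x i<..y i} \<inter> {x j<..y j} = {}" if "i < j" for i j
    using chain(2)[of i] incseqD[of x "Suc i" j] that by auto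
  have "disjoint_family (\<lambda>k. {x k<..y k})"
    unfolding disjoint_family_on_def
  proof (intro ballI impI)
    fix i j :: nat assume "i \<noteq> j"
    then consider "i < j" | "j < i" by linarith
    then show "{x i<..y i} \<inter> {x j<..y j} = {}"
      using dj[of i j] dj[of j i] by cases auto
  qed
  then have "h_log_measure h (\<Union>k. {x k<..y k}) = (\<Sum>k. h_log_measure h {x k<..y k})"
    by (intro h_log_measure_disjoint_UN) auto
  moreover have "(\<Sum>k. ennreal (half_line_deriv h (x k) * (1 - x k / y k))) \<le> \<dots>"
    using assms by (intro suminf_le h_log_measure_Ioc_ge) auto
  moreover have "(\<Sum>k. ennreal (half_line_deriv h (x k) * (1 - x k / y k))) = \<infinity>"
  proof (rule ccontr)
    assume "\<not> ?thesis"
    moreover have "0 \<le> half_line_deriv h (x k) * (1 - x k / y k)" for k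
    proof -
      have "0 < y k" using pos[of k] chain(1)[of k] by linarith
      then show ?thesis
        using L_plus_deriv_nonneg[OF assms(1), of "x k"] pos[of k] chain(1)[of k]
        by (intro mult_nonneg_nonneg) (auto simp: field_simps)
    qed
    ultimately have "summable (\<lambda>k. half_line_deriv h (x k) * (1 - x k / y k))"
      by (intro summable_suminf_not_top) auto
    with div show False ..
  qed
  ultimately show ?thesis by (simp add: top_unique)
qed

text \<open>Each dyadic block \<open>(s, 2 s]\<close> to the right of \<open>R\<close> contributes at least half of \<open>h' R\<close>.\<close>

lemma h_log_measure_Ioi_infinite:
  assumes "h \<in> L_plus" "0 < R"
  shows "h_log_measure h {R<..} = \<infinity>"
proof -
  have "h_log_measure h (\<Union>k. {R * 2 ^ k<..R * 2 ^ Suc k}) = \<infinity>"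
  proof (rule h_log_measure_chain_infinite[OF assms(1)])
    show "\<not> summable (\<lambda>k. half_line_deriv h (R * 2 ^ k) * (1 - R * 2 ^ k / (R * 2 ^ Suc k)))"
    proof
      assume "summable (\<lambda>k. half_line_deriv h (R * 2 ^ k) * (1 - R * 2 ^ k / (R * 2 ^ Suc k)))"
      then have "(\<lambda>k. half_line_deriv h (R * 2 ^ k) / 2) \<longlonglongrightarrow> 0"
        using assms(2) by (auto dest!: summable_LIMSEQ_zero simp: field_simps)
      moreover have "half_line_deriv h R / 2 \<le> half_line_deriv h (R * 2 ^ k) / 2" for k
        using assms by (intro divide_right_mono L_plus_deriv_mono) auto
      ultimately have "half_line_deriv h R / 2 \<le> 0"
        using LIMSEQ_le_const by blast
      then show False using L_plus_deriv_pos[OF assms] by simp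
    qed
  qed (use assms in auto)
  moreover have "(\<Union>k. {R * 2 ^ k<..R * 2 ^ Suc k}) \<subseteq> {R<..}"
  proof safe
    fix k r assume "r \<in> {R * 2 ^ k<..R * 2 ^ Suc k}"
    moreover have "R * 1 \<le> R * 2 ^ k" using assms by (intro mult_left_mono) auto
    ultimately show "R < r" by simp
  qed
  ultimately show ?thesis
    using h_log_measure_mono[of _ "{R<..}" h] by (metis infinity_ennreal_def top_unique)
qed

section \<open>Growth and the maximal term of functions of positive lower order\<close>

lemma max_modulus_bdd:
  assumes "f holomorphic_on UNIV"
  shows "bdd_above ((\<lambda>z. cmod (f z)) ` sphere 0 r)"
proof -
  have "continuous_on (sphere 0 r) (\<lambda>z. cmod (f z))"
    using assms by (intro continuous_intros holomorphic_on_imp_continuous_on)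
       (auto elim: holomorphic_on_subset)
  then have "compact ((\<lambda>z. cmod (f z)) ` sphere 0 r)"
    by (intro compact_continuous_image) auto
  then show ?thesis
    by (intro bounded_imp_bdd_above compact_imp_bounded)
qed

lemma norm_le_max_modulus:
  assumes holf: "f holomorphic_on UNIV" and "0 < r" "cmod z \<le> r"
  shows "cmod (f z) \<le> max_modulus f r"
proof (rule maximum_modulus_frontier[of f "cball 0 r"])
  show "f holomorphic_on interior (cball 0 r)" "continuous_on (closure (cball 0 r)) f"
    using holf by (auto elim: holomorphic_on_subset intro!: holomorphic_on_imp_continuous_on)
  fix w :: complex assume "w \<in> frontier (cball 0 r)"
  then show "cmod (f w) \<le> max_modulus f r"
    unfolding max_modulus_def using assms
    by (intro cSUP_upper max_modulus_bdd) auto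
qed (use assms in auto)

text \<open>Since \<open>ln\<close> is an even function on the reals, the defining inequality for \<open>ln (ln M)\<close> alone allows
  \<open>M\<close> to be as small as \<open>exp (- (r powr l))\<close>; the maximum principle rules this out.\<close>

lemma pos_lower_order_growth:
  assumes "f \<in> entire_pos_lower_order"
  shows "\<exists>l>0. \<forall>\<^sub>F r in at_top. exp (r powr l) \<le> max_modulus f r"
proof -
  have holf: "f holomorphic_on UNIV" and "0 < lower_order f"
    using assms by (auto simp: entire_pos_lower_order_def)
  then obtain x where x: "0 < x" "x < lower_order f" using dense by blast
  then obtain c where xc: "x = ereal c" by (cases x) auto
  with x have c: "0 < c" by simp
  have ev: "\<forall>\<^sub>F r in at_top. c < ln (ln (max_modulus f r)) / ln r"
    using less_LiminfD[of x at_top "\<lambda>r. ereal (ln (ln (max_modulus f r)) / ln r)"] x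
    unfolding lower_order_def xc by simp
  have nz: "\<exists>z0. f z0 \<noteq> 0"
  proof (rule ccontr)
    assume "\<nexists>z0. f z0 \<noteq> 0"
    then have zero: "max_modulus f r = 0" if "0 \<le> r" for r
      using that by (simp add: max_modulus_def)
    have "\<forall>\<^sub>F r in at_top. \<not> c < ln (ln (max_modulus f r)) / ln r"
      using eventually_ge_at_top[of 0] by (rule eventually_mono) (use c zero in simp)
    with ev have "\<forall>\<^sub>F r::real in at_top. False" by eventually_elim simp
    then show False by simp
  qed
  then obtain z0 where z0: "f z0 \<noteq> 0" by blast
  have "((\<lambda>r. exp (- (r powr c))) \<longlongrightarrow> 0) at_top"
    using c by real_asymp
  then have small: "\<forall>\<^sub>F r in at_top. exp (- (r powr c)) < cmod (f z0)"
    using z0 by (intro order_tendstoD) auto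
  have "\<forall>\<^sub>F r in at_top. exp (r powr c) \<le> max_modulus f r"
    using ev small eventually_gt_at_top[of 1] eventually_ge_at_top[of "cmod z0"]
  proof eventually_elim
    case (elim r)
    define L where "L = ln (max_modulus f r)"
    have M: "cmod (f z0) \<le> max_modulus f r"
      using elim by (intro norm_le_max_modulus[OF holf]) auto
    then have pos: "0 < max_modulus f r" using z0 by (meson less_le_trans zero_less_norm_iff)
    have *: "c * ln r < ln L" using elim by (simp add: L_def field_simps)
    moreover have "0 < c * ln r" using c elim by simp
    ultimately have "L \<noteq> 0" by auto
    have "ln L = ln \<bar>L\<bar>" by (simp add: abs_if ln_minus)
    with * \<open>L \<noteq> 0\<close> have "exp (c * ln r) < \<bar>L\<bar>" by (metis exp_less_cancel_iff exp_ln zero_less_abs_iff)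
    then have L: "r powr c < \<bar>L\<bar>" using elim by (simp add: powr_def)
    have M_eq: "max_modulus f r = exp L" using pos by (simp add: L_def)
    show ?case
    proof (cases "L < 0")
      case True
      then have "exp L < exp (- (r powr c))" using L by simp
      with M M_eq elim show ?thesis by simp
    qed (use L M_eq in simp)
  qed
  with c show ?thesis by blast
qed

lemma max_term_bdd:
  fixes a :: "nat \<Rightarrow> complex"
  assumes "\<And>z. summable (\<lambda>k. a k * z ^ n k)" "0 \<le> r"
  shows "bdd_above (range (\<lambda>k. cmod (a k) * r ^ n k))"
proof -
  have "(\<lambda>k. a k * of_real r ^ n k) \<longlonglongrightarrow> 0"
    using assms(1) by (rule summable_LIMSEQ_zero)
  then have "Bseq (\<lambda>k. a k * of_real r ^ n k)"
    by (intro convergent_imp_Bseq) (auto simp: convergent_def)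
  then obtain K where "\<And>k. cmod (a k * of_real r ^ n k) \<le> K"
    by (auto simp: Bseq_def)
  then show ?thesis
    using assms(2) by (intro bdd_aboveI[of _ K]) (auto simp: norm_mult norm_power)
qed

text \<open>Halving the radius gains a factor \<open>(1/2) ^ n k\<close>, at most \<open>(1/2) ^ k\<close>, in the \<open>k\<close>-th term.\<close>

lemma max_modulus_le_max_term_double:
  fixes a :: "nat \<Rightarrow> complex"
  assumes n: "strict_mono n" and sums: "\<And>z. (\<lambda>k. a k * z ^ n k) sums f z" and "0 \<le> r"
    and max: "\<And>k. cmod (a k) * (2 * r) ^ n k \<le> m"
  shows "max_modulus f r \<le> 2 * m"
  unfolding max_modulus_def
proof (rule cSUP_least)
  show "sphere (0::complex) r \<noteq> {}" using \<open>0 \<le> r\<close> by simp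
next
  fix z :: complex assume "z \<in> sphere 0 r"
  then have z: "cmod z = r" by simp
  have "0 \<le> cmod (a 0) * (2 * r) ^ n 0" using \<open>0 \<le> r\<close> by simp
  with max[of 0] have m0: "0 \<le> m" by linarith
  have le: "cmod (a k * z ^ n k) \<le> m * (1/2) ^ k" for k
  proof -
    have "cmod (a k * z ^ n k) = cmod (a k) * (2 * r) ^ n k * (1/2) ^ n k"
      by (simp add: norm_mult norm_power z power_mult_distrib power_one_over field_simps)
    also have "\<dots> \<le> m * (1/2) ^ n k" using max by (intro mult_right_mono) auto
    also have "\<dots> \<le> m * (1/2) ^ k"
      using m0 strict_mono_imp_increasing[OF n, of k] by (intro mult_left_mono power_decreasing) auto
    finally show ?thesis .
  qed
  have "cmod (\<Sum>k. a k * z ^ n k) \<le> (\<Sum>k. m * (1/2) ^ k)"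
    by (intro norm_suminf_le le summable_mult summable_geometric) auto
  also have "\<dots> = 2 * m"
    by (subst suminf_mult) (auto simp: suminf_geometric)
  finally show "cmod (f z) \<le> 2 * m" using sums[of z] by (simp add: sums_iff)
qed

text \<open>The largest term at \<open>r\<close> is at most \<open>K * r ^ n v\<close>, whereas the growth of \<open>f\<close> makes it at least
  \<open>exp ((r / 2) powr l) / 2\<close>; hence \<open>n v\<close> is at least about \<open>r powr l / ln r\<close>.\<close>

lemma central_index_lower_bound:
  fixes a :: "nat \<Rightarrow> complex"
  assumes "f \<in> entire_pos_lower_order" and n: "strict_mono n"
    and sums: "\<And>z. (\<lambda>k. a k * z ^ n k) sums f z"
  shows "\<exists>b>0. \<exists>R>0. \<forall>r\<ge>R. \<forall>v. (\<forall>k. cmod (a k) * r ^ n k \<le> cmod (a v) * r ^ n v)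
           \<longrightarrow> r \<le> real (n v) powr b"
proof -
  obtain l where l: "0 < l" "\<forall>\<^sub>F r in at_top. exp (r powr l) \<le> max_modulus f r"
    using pos_lower_order_growth[OF assms(1)] by blast
  have "bdd_above (range (\<lambda>k. cmod (a k) * 1 ^ n k))"
    using sums by (intro max_term_bdd) (auto simp: sums_iff)
  then obtain K0 where K0: "\<And>k. cmod (a k) \<le> K0" by (auto simp: bdd_above_def)
  define K where "K = max K0 1"
  have K: "0 < K" "\<And>k. cmod (a k) \<le> K"
    using K0 by (auto simp: K_def intro: max.coboundedI1)
  have half: "filterlim (\<lambda>r::real. r / 2) at_top at_top" by real_asymp
  have "\<forall>\<^sub>F r in at_top. exp ((r / 2) powr l) \<le> max_modulus f (r / 2)"
    using eventually_compose_filterlim[OF l(2) half] .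
  moreover have "\<forall>\<^sub>F r in at_top. r powr (l / 2) * ln r + ln (2 * K) \<le> (r / 2) powr l"
    using l(1) by real_asymp
  ultimately have "\<forall>\<^sub>F r in at_top. exp ((r / 2) powr l) \<le> max_modulus f (r / 2) \<and>
      r powr (l / 2) * ln r + ln (2 * K) \<le> (r / 2) powr l \<and> 1 < r"
    using eventually_gt_at_top[of 1] by eventually_elim simp
  then obtain R where R: "\<And>r. R \<le> r \<Longrightarrow> exp ((r / 2) powr l) \<le> max_modulus f (r / 2) \<and>
      r powr (l / 2) * ln r + ln (2 * K) \<le> (r / 2) powr l \<and> 1 < r"
    by (auto simp: eventually_at_top_linorder)
  have "\<forall>r\<ge>max R 1. \<forall>v. (\<forall>k. cmod (a k) * r ^ n k \<le> cmod (a v) * r ^ n v)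
      \<longrightarrow> r \<le> real (n v) powr (2 / l)"
  proof (intro allI impI)
    fix r v assume r: "max R 1 \<le> r" and max: "\<forall>k. cmod (a k) * r ^ n k \<le> cmod (a v) * r ^ n v"
    have r1: "1 < r" using R[of r] r by auto
    have "exp ((r / 2) powr l) \<le> max_modulus f (r / 2)" using R[of r] r by auto
    also have "\<dots> \<le> 2 * (cmod (a v) * r ^ n v)"
      using max r1 by (intro max_modulus_le_max_term_double[OF n sums]) auto
    also have "\<dots> \<le> (2 * K) * r ^ n v"
      using K r1 by (simp add: mult_right_mono)
    finally have "(r / 2) powr l \<le> ln ((2 * K) * r ^ n v)"
      using K r1 by (subst ln_ge_iff) auto
    also have "\<dots> = ln (2 * K) + real (n v) * ln r"
      using K r1 by (subst ln_mult) (auto simp: ln_realpow)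
    finally have "(r / 2) powr l \<le> ln (2 * K) + real (n v) * ln r" .
    moreover have "r powr (l / 2) * ln r + ln (2 * K) \<le> (r / 2) powr l"
      using R[of r] r by auto
    ultimately have "r powr (l / 2) * ln r \<le> real (n v) * ln r"
      by linarith
    then have le: "r powr (l / 2) \<le> real (n v)" using r1 by simp
    have "r = (r powr (l / 2)) powr (2 / l)" using l(1) r1 by (simp add: powr_powr)
    also have "\<dots> \<le> real (n v) powr (2 / l)" using l(1) le by (intro powr_mono2) auto
    finally show "r \<le> real (n v) powr (2 / l)" .
  qed
  moreover have "0 < 2 / l" "0 < max R 1" using l by auto
  ultimately show ?thesis by blast
qed

text \<open>With \<open>t\<close> the tails of the series, \<open>1 / sqrt t\<close> does it, because
  \<open>(t k - t (Suc k)) / sqrt (t k)\<close> is at most twice the telescoping difference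
  \<open>sqrt (t k) - sqrt (t (Suc k))\<close>. Adding a geometric series keeps the tails positive.\<close>

section \<open>Central indices of a series with nonnegative terms\<close>

text \<open>The terms are \<open>B k * s ^ n k\<close>. The lead has passed to an index above \<open>j\<close> once some later term is at
  least as large as all terms up to \<open>j\<close>. Once this has happened it remains so for
  larger radii. Working with the event instead of a formula for the radius at which it occurs avoids
  dividing by coefficients that may vanish.\<close>

definition overtaken :: "(nat \<Rightarrow> real) \<Rightarrow> (nat \<Rightarrow> nat) \<Rightarrow> nat \<Rightarrow> real \<Rightarrow> bool" where
  "overtaken B n j s \<longleftrightarrow> (\<exists>k>j. \<forall>i\<le>j. B i * s ^ n i \<le> B k * s ^ n k)"

lemma overtaken_mono:
  assumes n: "strict_mono n" and B: "\<And>k. 0 \<le> B k" and "0 < s" "s \<le> s'"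
    and "overtaken B n j s"
  shows "overtaken B n j s'"
proof -
  obtain k where k: "j < k" "\<And>i. i \<le> j \<Longrightarrow> B i * s ^ n i \<le> B k * s ^ n k"
    using assms by (auto simp: overtaken_def)
  define q where "q = s' / s"
  have q: "1 \<le> q" "s' = s * q" using assms by (auto simp: q_def)
  have "B i * s' ^ n i \<le> B k * s' ^ n k" if "i \<le> j" for i
  proof -
    have "B i * s' ^ n i = (B i * s ^ n i) * q ^ n i" by (simp add: q power_mult_distrib)
    also have "\<dots> \<le> (B k * s ^ n k) * q ^ n k"
      using k that q B \<open>0 < s\<close> strict_mono_less_eq[OF n, of i k]
      by (intro mult_mono[OF k(2)[OF that] power_increasing]) auto
    also have "\<dots> = B k * s' ^ n k" by (simp add: q power_mult_distrib)
    finally show ?thesis .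
  qed
  with k(1) show ?thesis by (auto simp: overtaken_def)
qed

lemma overtaken_antimono:
  assumes "i \<le> j" "overtaken B n j s"
  shows "overtaken B n i s"
  using assms by (auto simp: overtaken_def) (meson le_less_trans order_trans)

lemma not_overtaken_dominates:
  assumes "\<not> overtaken B n j s"
  shows "\<exists>v\<le>j. \<forall>k. B k * s ^ n k \<le> B v * s ^ n v"
proof -
  obtain v where v: "v \<le> j" "\<And>i. i \<le> j \<Longrightarrow> B i * s ^ n i \<le> B v * s ^ n v"
    using Max_in[of "(\<lambda>i. B i * s ^ n i) ` {..j}"] Max_ge[of "(\<lambda>i. B i * s ^ n i) ` {..j}"]
    by fastforce
  have "B k * s ^ n k \<le> B v * s ^ n v" for k
  proof (cases "k \<le> j")
    case False
    then obtain i where "i \<le> j" "B k * s ^ n k < B i * s ^ n i"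
      using assms unfolding overtaken_def by (meson not_le)
    with v show ?thesis by force
  qed (use v in auto)
  with v(1) show ?thesis by blast
qed

text \<open>Between the radius at which \<open>v - 1\<close> is overtaken and the radius at which \<open>v\<close> is overtaken, the leader
  must be \<open>v\<close> itself.\<close>

lemma first_not_overtaken_dominates:
  assumes "\<not> overtaken B n v s" and "v \<noteq> 0 \<Longrightarrow> overtaken B n (v - 1) s"
  shows "B k * s ^ n k \<le> B v * s ^ n v"
proof -
  obtain w where w: "w \<le> v" "\<And>k. B k * s ^ n k \<le> B w * s ^ n w"
    using not_overtaken_dominates[OF assms(1)] by blast
  have "B w * s ^ n w \<le> B v * s ^ n v"
  proof (cases "w = v")
    case False
    then have wv: "w \<le> v - 1" "v \<noteq> 0" using w(1) by auto
    with assms(2) obtain k where k: "v - 1 < k"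
      "\<And>i. i \<le> v - 1 \<Longrightarrow> B i * s ^ n i \<le> B k * s ^ n k"
      by (auto simp: overtaken_def)
    show ?thesis
    proof (cases "k = v")
      case False
      with k have "v < k" by linarith
      then obtain i where "i \<le> v" "B k * s ^ n k < B i * s ^ n i"
        using assms(1) by (auto simp: overtaken_def not_le)
      moreover have "B i * s ^ n i \<le> B k * s ^ n k" 
        using w(2)[of i] k(2)[OF wv(1)] by linarith
      ultimately show ?thesis by linarith
    qed (use k wv in auto)
  qed simp
  with w(2)[of k] show ?thesis by linarith
qed

lemma eventually_not_overtaken:
  assumes lim: "(\<lambda>k. B k * s ^ n k) \<longlonglongrightarrow> (0::real)" and nz: "0 < B i * s ^ n i"
  shows "\<exists>j. \<not> overtaken B n j s"
proof -
  have "\<forall>\<^sub>F k in sequentially. B k * s ^ n k < B i * s ^ n i"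
    using lim nz by (rule order_tendstoD)
  then obtain N where N: "\<And>k. N \<le> k \<Longrightarrow> B k * s ^ n k < B i * s ^ n i"
    by (auto simp: eventually_sequentially)
  have "\<not> overtaken B n (max i N) s"
  proof
    assume "overtaken B n (max i N) s"
    then obtain k where "max i N < k" "B i * s ^ n i \<le> B k * s ^ n k"
      by (auto simp: overtaken_def)
    with N[of k] show False by simp
  qed
  then show ?thesis ..
qed

text \<open>Let \<open>S j\<close> be the radius at which \<open>j\<close> is overtaken. Radii \<open>s\<close> with leader \<open>v\<close> are shifted to
  \<open>r = s * exp (\<tau> v)\<close>, so the values of \<open>r\<close> that are missed lie in the gaps that open when the shift grows.
  Cutting the gap that belongs to a jump over several indices at the intermediate shifts gives one
  interval for every \<open>j\<close>, of logarithmic length \<open>\<tau> (Suc j) - \<tau> j\<close>. The last clause makes the leader tend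
  to infinity with \<open>r\<close>.\<close>

lemma normal_values:
  fixes B :: "nat \<Rightarrow> real" and X :: "nat \<Rightarrow> real" and \<tau> :: "nat \<Rightarrow> real"
  assumes n: "strict_mono n" and B: "\<And>k. 0 \<le> B k" "\<exists>k. B k \<noteq> 0"
    and lim: "\<And>s. 0 < s \<Longrightarrow> (\<lambda>k. B k * s ^ n k) \<longlonglongrightarrow> 0"
    and X: "\<And>j s. X j < s \<Longrightarrow> overtaken B n j s" "\<And>j. 0 < X j"
    and \<tau>: "incseq \<tau>" "0 \<le> \<tau> 0"
  shows "\<exists>S. (\<forall>j. 0 \<le> S j \<and> S j \<le> X j) \<and>
           (\<forall>r>0. (\<forall>j. r \<notin> {S j * exp (\<tau> j)..S j * exp (\<tau> (Suc j))}) \<longrightarrow>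
              (\<exists>v. (\<forall>k. B k * (r * exp (- \<tau> v)) ^ n k \<le> B v * (r * exp (- \<tau> v)) ^ n v) \<and>
                   (\<forall>N. S N * exp (\<tau> N) \<le> r \<longrightarrow> N < v)))"
proof -
  define U where "U j = {s. 0 < s \<and> overtaken B n j s}" for j
  define S where "S j = Inf (U j)" for j
  have XU: "s \<in> U j" if "X j < s" for s j
    using X(1)[OF that] X(2)[of j] that by (auto simp: U_def)
  have ne: "U j \<noteq> {}" for j using XU[of j "X j + 1"] by auto
  have bdd: "bdd_below (U j)" for j by (rule bdd_belowI[of _ 0]) (auto simp: U_def)
  have S0: "0 \<le> S j" for j
    unfolding S_def by (intro cInf_greatest ne) (auto simp: U_def)
  have SX: "S j \<le> X j" for j
    unfolding S_def by (rule dense_ge) (intro cInf_lower bdd XU)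
  have S_inc: "incseq S"
    unfolding S_def
    by (intro incseq_SucI cInf_superset_mono ne bdd) (auto simp: U_def intro: overtaken_antimono[rotated])
  have above: "overtaken B n j s" if gt: "S j < s" for j s
  proof -
    obtain s0 where "s0 \<in> U j" "s0 < s"
      using gt cInf_lessD[OF ne[of j]] unfolding S_def by blast
    then show ?thesis
      using overtaken_mono[of n B s0 s j] n B(1) by (auto simp: U_def)
  qed
  have below: "\<not> overtaken B n j s" if "0 < s" "s < S j" for j s
    using that cInf_lower[OF _ bdd, of s j] by (auto simp: U_def S_def)
  have unbdd: "\<exists>j. r < S j" if "0 < r" for r
  proof -
    obtain i where "B i \<noteq> 0" using B(2) by blast
    then have pos: "0 < B i * (2 * r) ^ n i" using B(1)[of i] that by simp
    have "0 < 2 * r" using that by simp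
    then obtain j where j: "\<not> overtaken B n j (2 * r)"
      using eventually_not_overtaken[OF lim pos] by blast
    then have "2 * r \<le> S j" using above[of j "2 * r"] by (meson not_le)
    with that show ?thesis by (intro exI[of _ j]) auto
  qed
  have \<tau>0: "0 \<le> \<tau> j" for j using \<tau> incseqD[OF \<tau>(1), of 0 j] by auto
  have left_inc: "S i * exp (\<tau> i) \<le> S j * exp (\<tau> j)" if "i \<le> j" for i j
    using incseqD[OF S_inc that] incseqD[OF \<tau>(1) that] S0 by (intro mult_mono) auto
  have "\<exists>v. (\<forall>k. B k * (r * exp (- \<tau> v)) ^ n k \<le> B v * (r * exp (- \<tau> v)) ^ n v) \<and>
            (\<forall>N. S N * exp (\<tau> N) \<le> r \<longrightarrow> N < v)"
    if r: "0 < r" and out: "\<forall>j. r \<notin> {S j * exp (\<tau> j)..S j * exp (\<tau> (Suc j))}" for r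
  proof -
    have "\<exists>j. r < S j * exp (\<tau> j)"
    proof -
      obtain j where "r < S j" using unbdd[OF r] by blast
      also have "S j * 1 \<le> S j * exp (\<tau> j)" using S0 \<tau>0 by (intro mult_left_mono) auto
      finally show ?thesis by auto
    qed
    \<comment> \<open>The left endpoints increase to infinity; \<open>v\<close> is the first one beyond \<open>r\<close>.\<close>
    define v where "v = (LEAST j. r < S j * exp (\<tau> j))"
    have v: "r < S v * exp (\<tau> v)"
      unfolding v_def using \<open>\<exists>j. r < S j * exp (\<tau> j)\<close> by (rule LeastI_ex)
    define s where "s = r * exp (- \<tau> v)"
    have s: "0 < s" "r = s * exp (\<tau> v)" using r by (auto simp: s_def exp_minus)
    have "\<not> overtaken B n v s" using v s by (intro below) auto
    moreover have "overtaken B n (v - 1) s" if "v \<noteq> 0"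
    proof -
      have "\<not> r < S (v - 1) * exp (\<tau> (v - 1))"
        unfolding v_def by (rule not_less_Least) (use that v_def in simp)
      with out[rule_format, of "v - 1"] have "S (v - 1) * exp (\<tau> v) < r" using that by auto
      then show ?thesis unfolding s(2) by (intro above) simp
    qed
    ultimately have "B k * s ^ n k \<le> B v * s ^ n v" for k
      by (rule first_not_overtaken_dominates)
    moreover have "N < v" if "S N * exp (\<tau> N) \<le> r" for N
      using left_inc[of v N] v that by (meson leD le_less_trans not_le)
    ultimately show ?thesis unfolding s_def by blast
  qed
  with S0 SX show ?thesis by (intro exI[of _ S]) blast
qed

section \<open>A convex change of the coefficients\<close>

lemma summable_slow_weights:
  fixes u :: "nat \<Rightarrow> real"
  assumes u: "summable u" "\<And>k. 0 \<le> u k"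
  shows "\<exists>c. incseq c \<and> (\<forall>k. 1 \<le> c k) \<and> filterlim c at_top sequentially \<and>
             summable (\<lambda>k. c k * u k)"
proof -
  define v where "v k = u k + (1/2) ^ k" for k
  define t where "t k = (\<Sum>i. v (i + k))" for k
  have v: "summable v" "\<And>k. 0 < v k" "\<And>k. u k \<le> v k"
    unfolding v_def using u by (auto intro!: summable_add summable_geometric add_nonneg_pos)
  have vk: "summable (\<lambda>i. v (i + k))" for k using v(1) by (simp add: summable_iff_shift)
  have t_pos: "0 < t k" for k
    unfolding t_def using v(2) vk by (intro suminf_pos) auto
  have t_Suc: "t k = v k + t (Suc k)" for k
    unfolding t_def using suminf_split_head[OF vk[of k]] by simp
  have t_dec: "t (Suc k) \<le> t k" for k using t_Suc[of k] v(2)[of k] by linarith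
  have t_eq: "t = (\<lambda>k. suminf v - (\<Sum>i<k. v i))"
    unfolding t_def by (simp add: suminf_minus_initial_segment v(1))
  have "(\<lambda>k. suminf v - (\<Sum>i<k. v i)) \<longlonglongrightarrow> suminf v - suminf v"
    by (intro tendsto_diff tendsto_const summable_LIMSEQ v(1))
  then have t0: "t \<longlonglongrightarrow> 0" by (simp add: t_eq)
  define c where "c k = sqrt (t 0) / sqrt (t k)" for k
  have t_le: "t k \<le> t 0" for k using decseq_SucI[of t] t_dec by (auto simp: decseq_def)
  have "incseq c"
    unfolding c_def using t_dec t_pos
    by (intro incseq_SucI divide_left_mono) (auto simp: less_imp_le)
  moreover have "1 \<le> c k" for k
    unfolding c_def using t_pos t_le[of k] by simp
  moreover have "filterlim c at_top sequentially"
  proof -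
    have "(\<lambda>k. sqrt (t k)) \<longlonglongrightarrow> 0" using tendsto_real_sqrt[OF t0] by simp
    then have "filterlim (\<lambda>k. inverse (sqrt (t k))) at_top sequentially"
      using t_pos by (intro filterlim_inverse_at_top) auto
    then have "filterlim (\<lambda>k. sqrt (t 0) * inverse (sqrt (t k))) at_top sequentially"
      using t_pos by (intro filterlim_tendsto_pos_mult_at_top[OF tendsto_const]) auto
    then show ?thesis by (simp add: c_def[abs_def] field_simps)
  qed
  moreover have "summable (\<lambda>k. c k * u k)"
  proof (rule summable_comparison_test')
    have "summable (\<lambda>k. sqrt (t k) - sqrt (t (Suc k)))"
      using tendsto_real_sqrt[OF t0] by (intro telescope_summable')
    then show "summable (\<lambda>k. 2 * sqrt (t 0) * (sqrt (t k) - sqrt (t (Suc k))))"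
      by (rule summable_mult)
    fix k :: nat
    have "v k = (sqrt (t k) - sqrt (t (Suc k))) * (sqrt (t k) + sqrt (t (Suc k)))"
      using t_Suc[of k] t_pos[of k] t_pos[of "Suc k"] by (simp add: algebra_simps)
    also have "\<dots> \<le> (sqrt (t k) - sqrt (t (Suc k))) * (2 * sqrt (t k))"
      using t_dec[of k] by (intro mult_left_mono) auto
    finally have "c k * v k \<le> c k * ((sqrt (t k) - sqrt (t (Suc k))) * (2 * sqrt (t k)))"
      using \<open>1 \<le> c k\<close> by (intro mult_left_mono) auto
    also have "\<dots> = 2 * sqrt (t 0) * (sqrt (t k) - sqrt (t (Suc k)))"
      unfolding c_def using t_pos[of k] by (simp add: field_simps)
    finally have "c k * v k \<le> 2 * sqrt (t 0) * (sqrt (t k) - sqrt (t (Suc k)))" .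
    moreover have "c k * u k \<le> c k * v k"
      using v(3) \<open>1 \<le> c k\<close> by (intro mult_left_mono) auto
    moreover have "0 \<le> c k * u k" using u(2)[of k] \<open>1 \<le> c k\<close> by simp
    ultimately show "norm (c k * u k) \<le> 2 * sqrt (t 0) * (sqrt (t k) - sqrt (t (Suc k)))"
      by simp
  qed
  ultimately show ?thesis by blast
qed

text \<open>As a function of \<open>n k\<close>, \<open>T\<close> is piecewise linear with slope \<open>\<tau> k + \<delta> k / 2\<close> on the \<open>k\<close>-th gap, so the
  line of slope \<open>\<tau> v\<close> through the vertex \<open>v\<close> supports it. Every gap between \<open>v\<close> and \<open>k\<close> moves \<open>T\<close> away from this
  line by at least half of \<open>\<delta> j\<close> times the gap, which is \<open>c j\<close>. The first gap next to \<open>v\<close> yields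
  at least \<open>c (v - 1)\<close> and each further one at least \<open>1\<close>; for \<open>v = 0\<close> the truncated \<open>v - 1\<close> is \<open>0\<close>, and \<open>c 0\<close> is
  indeed the first contribution.\<close>

lemma convex_weights_above_tangent:
  fixes n :: "nat \<Rightarrow> nat" and c \<delta> \<tau> T :: "nat \<Rightarrow> real"
  assumes n: "strict_mono n"
    and \<tau>: "\<And>j. \<tau> (Suc j) = \<tau> j + \<delta> j"
    and gap: "\<And>j. \<delta> j * (real (n (Suc j)) - real (n j)) = 2 * c j"
    and c: "incseq c" "\<And>j. 1 \<le> c j"
    and T: "\<And>k. T (Suc k) = T k + (\<tau> k + \<delta> k / 2) * (real (n (Suc k)) - real (n k))"
    and "k \<noteq> v"
  shows "c (v - 1) - 1 + real ((k - v) + (v - k)) \<le> T k - T v - \<tau> v * (real (n k) - real (n v))"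
proof -
  define D where "D k = T k - T v - \<tau> v * (real (n k) - real (n v))" for k
  have g: "0 < real (n (Suc j)) - real (n j)" for j
    using n by (simp add: strict_mono_Suc_iff)
  have \<delta>: "0 < \<delta> j" for j
  proof -
    have "0 < \<delta> j * (real (n (Suc j)) - real (n j))" using gap[of j] c(2)[of j] by simp
    then show ?thesis using g[of j] by (simp add: zero_less_mult_iff)
  qed
  have \<tau>_inc: "incseq \<tau>" using \<tau> \<delta> by (intro incseq_SucI) (simp add: less_imp_le)
  have step: "D (Suc j) - D j = (\<tau> j - \<tau> v) * (real (n (Suc j)) - real (n j)) + c j" for j
    unfolding D_def T using gap[of j] by (simp add: algebra_simps)
  have up: "c j \<le> D (Suc j) - D j" if "v \<le> j" for j
    unfolding step using incseqD[OF \<tau>_inc that] g[of j] by simp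
  have down: "c j \<le> D j - D (Suc j)" if "j < v" for j
  proof -
    have "(\<tau> (Suc j) - \<tau> v) * (real (n (Suc j)) - real (n j)) \<le> 0"
      using incseqD[OF \<tau>_inc, of "Suc j" v] that g[of j] by (intro mult_nonpos_nonneg) auto
    then show ?thesis using step[of j] gap[of j] by (simp add: \<tau> algebra_simps)
  qed
  have Dv: "D v = 0" by (simp add: D_def)
  have above: "c (v - 1) + real m \<le> D (v + Suc m)" for m
  proof (induction m)
    case 0
    then show ?case using up[of v] Dv incseqD[OF c(1), of "v - 1" v] by simp
  next
    case (Suc m)
    then show ?case using up[of "v + Suc m"] c(2)[of "v + Suc m"] by simp
  qed
  have beneath: "c (v - 1) + real m \<le> D j" if "j + Suc m = v" for m j
    using that
  proof (induction m arbitrary: j)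
    case 0
    then show ?case using down[of j] Dv by auto
  next
    case (Suc m)
    then have "c (v - 1) + real m \<le> D (Suc j)" "c j \<le> D j - D (Suc j)"
      using Suc.IH[of "Suc j"] down[of j] by auto
    then show ?case using c(2)[of j] by simp
  qed
  show ?thesis
  proof (cases "k < v")
    case True
    then show ?thesis using beneath[of k "v - k - 1"] by (simp add: D_def of_nat_diff)
  next
    case False
    then have "v < k" using \<open>k \<noteq> v\<close> by simp
    then show ?thesis using above[of "k - v - 1"] by (simp add: D_def of_nat_diff)
  qed
qed

text \<open>Undoing the factors \<open>exp (T k)\<close> and the shift of the radius by \<open>exp \<theta>\<close> turns dominance of one term in
  the modified series into dominance in the original one with an explicit surplus.\<close>

lemma tilted_dominance:
  fixes A T :: "nat \<Rightarrow> real"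
  assumes "A k * exp (T k) * (r * exp (- \<theta>)) ^ n k \<le> A v * exp (T v) * (r * exp (- \<theta>)) ^ n v"
  shows "A k * r ^ n k \<le> A v * r ^ n v * exp (- (T k - T v - \<theta> * (real (n k) - real (n v))))"
proof -
  have *: "A i * exp (T i) * (r * exp (- \<theta>)) ^ n i = A i * r ^ n i * exp (T i - \<theta> * real (n i))" for i
    by (simp add: power_mult_distrib exp_of_nat_mult[symmetric] exp_diff exp_minus field_simps)
  have "A k * r ^ n k = (A k * r ^ n k * exp (T k - \<theta> * real (n k))) * exp (- (T k - \<theta> * real (n k)))"
    by (simp add: mult.assoc flip: exp_add)
  also have "\<dots> \<le> (A v * r ^ n v * exp (T v - \<theta> * real (n v))) * exp (- (T k - \<theta> * real (n k)))"
    using assms unfolding * by (intro mult_right_mono) auto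
  also have "\<dots> = A v * r ^ n v * exp (- (T k - T v - \<theta> * (real (n k) - real (n v))))"
    by (simp add: mult.assoc right_diff_distrib flip: exp_add)
  finally show ?thesis .
qed

text \<open>In truncated subtraction, \<open>(k - v) + (v - k)\<close> is the distance of \<open>k\<close> and \<open>v\<close>.\<close>

lemma two_sided_geometric_sums:
  "summable (\<lambda>k. (1/2::real) ^ ((k - v) + (v - k)))"
  "(\<Sum>k. (1/2::real) ^ ((k - v) + (v - k))) \<le> 3"
proof -
  let ?g = "\<lambda>k. (1/2::real) ^ ((k - v) + (v - k))"
  have shift: "(\<lambda>i. ?g (i + v)) = (\<lambda>i. (1/2) ^ i)" by auto
  show sm: "summable ?g"
    using summable_iff_shift[of ?g v] unfolding shift by (simp add: summable_geometric)
  have fin: "(\<Sum>k<v. (1/2::real) ^ (v - k)) \<le> 1"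
  proof -
    have "(\<Sum>k<v. (1/2::real) ^ (v - k)) = 1 - (1/2) ^ v"
      by (induction v) (simp_all add: Suc_diff_le sum_divide_distrib[symmetric])
    then show ?thesis by simp
  qed
  have "suminf ?g = (\<Sum>i. ?g (i + v)) + (\<Sum>k<v. ?g k)"
    by (rule suminf_split_initial_segment[OF sm])
  also have "(\<Sum>i. ?g (i + v)) = 2" unfolding shift by (simp add: suminf_geometric)
  also have "(\<Sum>k<v. ?g k) = (\<Sum>k<v. (1/2::real) ^ (v - k))" by (intro sum.cong) auto
  finally show "suminf ?g \<le> 3" using fin by simp
qed

lemma dominant_term_approximates:
  fixes a :: "nat \<Rightarrow> complex"
  assumes sums: "(\<lambda>k. a k * z ^ n k) sums w" and "0 \<le> q"
    and dom: "\<And>k. k \<noteq> v \<Longrightarrow> cmod (a k) * cmod z ^ n k \<le> q * (1/2) ^ ((k - v) + (v - k))"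
  shows "cmod (w - a v * z ^ n v) \<le> 3 * q"
proof -
  have "(\<lambda>k. a k * z ^ n k - (if k = v then a k * z ^ n k else 0)) sums (w - a v * z ^ n v)"
    by (intro sums_diff sums sums_single)
  then have eq: "w - a v * z ^ n v = (\<Sum>k. a k * z ^ n k - (if k = v then a k * z ^ n k else 0))"
    by (simp add: sums_iff)
  have "cmod (w - a v * z ^ n v) \<le> (\<Sum>k. q * (1/2) ^ ((k - v) + (v - k)))"
    unfolding eq
    using dom \<open>0 \<le> q\<close>
    by (intro norm_suminf_le summable_mult two_sided_geometric_sums) (auto simp: norm_mult norm_power)
  also have "\<dots> = q * (\<Sum>k. (1/2) ^ ((k - v) + (v - k)))"
    by (intro suminf_mult two_sided_geometric_sums)
  also have "\<dots> \<le> q * 3"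
    using \<open>0 \<le> q\<close> by (intro mult_left_mono two_sided_geometric_sums)
  finally show ?thesis by simp
qed

text \<open>Complementing \<open>E\<close> inside the filter means that the estimates may fail on \<open>E\<close>. Uniform closeness of
  \<open>cmod (f z)\<close> to \<open>\<mu> r\<close> on the circle transfers to the supremum and to the infimum.\<close>

lemma asymp_equiv_of_dominant_term:
  assumes "\<And>\<epsilon>. 0 < \<epsilon> \<Longrightarrow> \<forall>\<^sub>F r in at_top. r \<notin> E \<longrightarrow>
     0 < \<mu> r \<and> (\<forall>z\<in>sphere 0 r. \<bar>cmod (f z) - \<mu> r\<bar> \<le> \<epsilon> * \<mu> r)"
  shows "max_modulus f \<sim>[inf at_top (principal (- E))] \<mu>"
    and "min_modulus f \<sim>[inf at_top (principal (- E))] \<mu>"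
proof -
  have *: "\<forall>\<^sub>F r in inf at_top (principal (- E)).
      dist (max_modulus f r / \<mu> r) 1 < e \<and> dist (min_modulus f r / \<mu> r) 1 < e" if "0 < e" for e
  proof -
    have half: "0 < e / 2" using that by simp
    have "\<forall>\<^sub>F r in at_top. r \<notin> E \<longrightarrow>
        dist (max_modulus f r / \<mu> r) 1 < e \<and> dist (min_modulus f r / \<mu> r) 1 < e"
      using assms[OF half] eventually_ge_at_top[of 0]
    proof eventually_elim
      case (elim r)
      show ?case
      proof
        assume "r \<notin> E"
        with elim that have \<mu>: "0 < \<mu> r"
          and near: "\<And>z. z \<in> sphere 0 r \<Longrightarrow> \<bar>cmod (f z) - \<mu> r\<bar> \<le> e / 2 * \<mu> r" by auto
        have bd: "cmod (f z) \<le> (1 + e / 2) * \<mu> r" "(1 - e / 2) * \<mu> r \<le> cmod (f z)"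
          if "z \<in> sphere 0 r" for z
          using near[OF that] unfolding abs_le_iff by (simp_all add: algebra_simps)
        have r: "of_real r \<in> sphere (0::complex) r" using elim by simp
        then have ne: "sphere (0::complex) r \<noteq> {}" by blast
        have "max_modulus f r \<le> (1 + e / 2) * \<mu> r" "(1 - e / 2) * \<mu> r \<le> min_modulus f r"
          unfolding max_modulus_def min_modulus_def using ne bd
          by (intro cSUP_least cINF_greatest; blast)+
        moreover have "(1 - e / 2) * \<mu> r \<le> max_modulus f r"
          unfolding max_modulus_def
          by (rule cSUP_upper2[where x = "of_real r"]) (rule bdd_aboveI2 bd r, assumption?)+
        moreover have "min_modulus f r \<le> (1 + e / 2) * \<mu> r"
          unfolding min_modulus_def
          by (rule cINF_lower2[where x = "of_real r"]) (rule bdd_belowI2 bd r, assumption?)+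
        ultimately have "\<bar>max_modulus f r / \<mu> r - 1\<bar> \<le> e / 2" "\<bar>min_modulus f r / \<mu> r - 1\<bar> \<le> e / 2"
          unfolding abs_le_iff using \<mu> by (auto simp: field_simps)
        then show "dist (max_modulus f r / \<mu> r) 1 < e \<and> dist (min_modulus f r / \<mu> r) 1 < e"
          using that by (auto simp: dist_real_def)
      qed
    qed
    then show ?thesis by (simp add: eventually_inf_principal)
  qed
  show "max_modulus f \<sim>[inf at_top (principal (- E))] \<mu>"
    using * by (intro asymp_equivI' tendstoI) (force elim: eventually_mono)
  show "min_modulus f \<sim>[inf at_top (principal (- E))] \<mu>"
    using * by (intro asymp_equivI' tendstoI) (force elim: eventually_mono)
qed

section \<open>Convergence implies regular behaviour off a small set\<close>

lemma exp_minus_one_le: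
  "exp x - 1 \<le> x * exp (x::real)"
proof -
  have "(1 - x) * exp x \<le> exp (- x) * exp x"
    using exp_ge_add_one_self[of "- x"] by (intro mult_right_mono) auto
  then show ?thesis by (simp add: algebra_simps exp_minus)
qed

lemma exp_diff_nat: "exp (x - real m) = exp x * exp (- 1) ^ m"
  by (simp add: exp_of_nat_mult[of m "- 1 :: real", symmetric] flip: exp_add)

text \<open>The modified series \<open>B\<close> has the exceptional intervals \<open>[L j, H j]\<close>. Their measure needs \<open>h' (H j)\<close> to be
  controlled by \<open>h' (n j powr (b + 1))\<close>: the central index bound gives \<open>S j \<le> max R (n j powr b)\<close>, and the
  exponent \<open>b + 1\<close> absorbs the bounded factor \<open>exp \<Delta>\<close> for large \<open>j\<close>. The finitely many remaining intervals
  are covered by \<open>[1, R0]\<close>.\<close>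

lemma relation_off_exceptional_set:
  fixes a :: "nat \<Rightarrow> complex"
  assumes h: "h \<in> L_plus" and n: "strict_mono n"
    and cond: "\<And>b. 0 < b \<Longrightarrow> summable (\<lambda>k. 1 / (real (n (Suc k)) - real (n k)) *
                                half_line_deriv h (real (n k) powr b))"
    and f: "f \<in> entire_pos_lower_order" and sums: "\<And>z. (\<lambda>k. a k * z ^ n k) sums f z"
  shows "\<exists>E \<in> sets borel. E \<subseteq> {1..} \<and> h_log_measure h E < \<infinity> \<and>
               max_modulus f \<sim>[inf at_top (principal (- E))] min_modulus f \<and>
               max_modulus f \<sim>[inf at_top (principal (- E))] max_term a n"
proof -
  obtain b R where b: "0 < b" "0 < R"
    and central: "\<And>r v. R \<le> r \<Longrightarrow> (\<And>k. cmod (a k) * r ^ n k \<le> cmod (a v) * r ^ n v)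
           \<Longrightarrow> r \<le> real (n v) powr b"
    using central_index_lower_bound[OF f n sums] by blast
  define g where "g j = real (n (Suc j)) - real (n j)" for j
  have g: "0 < g j" for j using n by (simp add: g_def strict_mono_Suc_iff)
  define y where "y j = half_line_deriv h (real (n j) powr (b + 1))" for j
  have y: "0 \<le> y j" for j unfolding y_def by (intro L_plus_deriv_nonneg h) auto
  have sum_y: "summable (\<lambda>j. 1 / g j * y j)"
    unfolding g_def y_def using cond[of "b + 1"] b by simp
  \<comment> \<open>The derivative of \<open>h\<close> is bounded below on \<open>[1, \<infinity>)\<close>, so the gaps themselves have a convergent
    reciprocal sum; this keeps \<open>\<tau>\<close> bounded.\<close>
  have sum_1: "summable (\<lambda>j. 1 / g j)"
  proof (rule summable_comparison_test')
    define d where "d = half_line_deriv h 1"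
    have d: "0 < d" unfolding d_def by (intro L_plus_deriv_pos h) auto
    show "summable (\<lambda>j. 1 / d * (1 / g j * y j))" by (intro summable_mult sum_y)
    fix j :: nat assume "1 \<le> j"
    then have "1 \<le> real (n j)" using strict_mono_imp_increasing[OF n, of j] by simp
    then have "1 powr (b + 1) \<le> real (n j) powr (b + 1)" using b by (intro powr_mono2) auto
    then have "d \<le> y j" unfolding d_def y_def by (intro L_plus_deriv_mono h) auto
    then have "1 / g j * 1 \<le> 1 / g j * (y j / d)"
      using g[of j] d by (intro mult_left_mono) auto
    then show "norm (1 / g j) \<le> 1 / d * (1 / g j * y j)" using g[of j] by (simp add: mult.commute)
  qed
  obtain c where c: "incseq c" "\<And>j. 1 \<le> c j" "filterlim c at_top sequentially"
    and sum_c: "summable (\<lambda>j. c j * (1 / g j + 1 / g j * y j))"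
    using summable_slow_weights[OF summable_add[OF sum_1 sum_y]] g y
    by (auto simp: less_imp_le)
  define \<delta> where "\<delta> j = 2 * c j / g j" for j
  have \<delta>: "0 < \<delta> j" for j unfolding \<delta>_def using g[of j] c(2)[of j] by simp
  have gap: "\<delta> j * g j = 2 * c j" for j unfolding \<delta>_def using g[of j] by simp
  have sum_\<delta>y: "summable (\<lambda>j. \<delta> j * y j)" and sum_\<delta>: "summable \<delta>"
  proof -
    have "\<delta> j * y j \<le> 2 * (c j * (1 / g j + 1 / g j * y j))"
         "\<delta> j \<le> 2 * (c j * (1 / g j + 1 / g j * y j))" for j
      unfolding \<delta>_def using g[of j] c(2)[of j] y[of j] by (auto simp: field_simps)
    then show "summable (\<lambda>j. \<delta> j * y j)" "summable \<delta>"
      using \<delta> y by (auto intro!: summable_comparison_test'[OF summable_mult[OF sum_c], of 0 _ 2]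
        simp: abs_mult less_imp_le)
  qed
  define \<tau> where "\<tau> j = (\<Sum>i<j. \<delta> i)" for j
  define \<Delta> where "\<Delta> = suminf \<delta>"
  have \<tau>_Suc: "\<tau> (Suc j) = \<tau> j + \<delta> j" for j by (simp add: \<tau>_def)
  have \<tau>_inc: "incseq \<tau>" using \<tau>_Suc \<delta> by (intro incseq_SucI) (simp add: less_imp_le)
  have \<tau>0: "\<tau> 0 = 0" by (simp add: \<tau>_def)
  then have \<tau>_nonneg: "0 \<le> \<tau> j" for j using incseqD[OF \<tau>_inc, of 0 j] by simp
  have \<tau>_le: "\<tau> j \<le> \<Delta>" for j
    unfolding \<tau>_def \<Delta>_def using \<delta> by (intro sum_le_suminf sum_\<delta>) (auto simp: less_imp_le)
  \<comment> \<open>Slopes halfway between \<open>\<tau> j\<close> and \<open>\<tau> (Suc j)\<close> leave the same room on both sides of a vertex; as they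
    stay below \<open>\<Delta>\<close>, the modified series still converges everywhere.\<close>
  define T where "T k = (\<Sum>j<k. (\<tau> j + \<delta> j / 2) * g j)" for k
  have T_Suc: "T (Suc k) = T k + (\<tau> k + \<delta> k / 2) * (real (n (Suc k)) - real (n k))" for k
    by (simp add: T_def g_def)
  have T_le: "T k \<le> \<Delta> * real (n k)" for k
  proof (induction k)
    case (Suc k)
    have "\<tau> k + \<delta> k / 2 \<le> \<Delta>" using \<tau>_le[of "Suc k"] \<tau>_Suc[of k] \<delta>[of k] by simp
    then have "(\<tau> k + \<delta> k / 2) * g k \<le> \<Delta> * g k" using g[of k] by (intro mult_right_mono) auto
    then show ?case using Suc T_Suc[of k] by (simp add: g_def algebra_simps)
  qed (use \<tau>_le[of 0] \<tau>0 in \<open>simp add: T_def\<close>)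
  have tangent: "c (v - 1) - 1 + real ((k - v) + (v - k)) \<le> T k - T v - \<tau> v * (real (n k) - real (n v))"
    if "k \<noteq> v" for k v
    using that by (intro convex_weights_above_tangent[OF n \<tau>_Suc gap[unfolded g_def] c(1,2) T_Suc])
  define B where "B k = cmod (a k) * exp (T k)" for k
  have B0: "0 \<le> B k" for k by (simp add: B_def)
  have separated: "cmod (a k) * r ^ n k \<le>
      cmod (a v) * r ^ n v * (exp (1 - c (v - 1)) * (1/2) ^ ((k - v) + (v - k)))"
    if dom: "\<And>k. B k * (r * exp (- \<tau> v)) ^ n k \<le> B v * (r * exp (- \<tau> v)) ^ n v"
      and "0 < r" "k \<noteq> v" for r v k
  proof -
    let ?m = "(k - v) + (v - k)"
    have "cmod (a k) * r ^ n k \<le> cmod (a v) * r ^ n v *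
        exp (- (T k - T v - \<tau> v * (real (n k) - real (n v))))"
      using dom[of k] unfolding B_def by (rule tilted_dominance)
    also have "\<dots> \<le> cmod (a v) * r ^ n v * (exp (1 - c (v - 1)) * (1/2) ^ ?m)"
    proof (intro mult_left_mono)
      have "exp (- (T k - T v - \<tau> v * (real (n k) - real (n v)))) \<le> exp (1 - c (v - 1) - real ?m)"
        using tangent[OF \<open>k \<noteq> v\<close>] by simp
      also have "\<dots> = exp (1 - c (v - 1)) * exp (- 1) ^ ?m"
        by (rule exp_diff_nat)
      also have "\<dots> \<le> exp (1 - c (v - 1)) * (1/2) ^ ?m"
      proof (intro mult_left_mono power_mono)
        have "2 \<le> exp (1::real)" using exp_ge_add_one_self[of 1] by simp
        then show "exp (- 1) \<le> (1/2::real)" by (simp add: exp_minus field_simps)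
      qed auto
      finally show "exp (- (T k - T v - \<tau> v * (real (n k) - real (n v)))) \<le>
        exp (1 - c (v - 1)) * (1/2) ^ ?m" .
    qed (use \<open>0 < r\<close> in auto)
    finally show ?thesis .
  qed
  have dominant: "cmod (a k) * r ^ n k \<le> cmod (a v) * r ^ n v"
    if "\<And>k. B k * (r * exp (- \<tau> v)) ^ n k \<le> B v * (r * exp (- \<tau> v)) ^ n v" "0 < r" for r v k
  proof (cases "k = v")
    case False
    have "exp (1 - c (v - 1)) * (1/2) ^ ((k - v) + (v - k)) \<le> 1 * 1"
      using c(2)[of "v - 1"] by (intro mult_mono power_le_one) auto
    then have "cmod (a v) * r ^ n v * (exp (1 - c (v - 1)) * (1/2) ^ ((k - v) + (v - k)))
        \<le> cmod (a v) * r ^ n v * 1"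
      using \<open>0 < r\<close> by (intro mult_left_mono) auto
    with separated[OF that(1,2) False] show ?thesis by simp
  qed simp
  have summ: "summable (\<lambda>k. a k * z ^ n k)" for z using sums by (rule sums_summable)
  have nonzero: "\<exists>k. a k \<noteq> 0"
  proof (rule ccontr)
    assume "\<nexists>k. a k \<noteq> 0"
    then have "r \<le> real (n 0) powr b" if "R \<le> r" for r
      using that by (intro central) auto
    from this[of "max R (real (n 0) powr b + 1)"] show False by auto
  qed
  \<comment> \<open>Beyond \<open>X j\<close> a leader \<open>v \<le> j\<close> would be a central index of \<open>f\<close> that is too small.\<close>
  define X where "X j = max R (real (n j) powr b)" for j
  have "\<exists>S. (\<forall>j. 0 \<le> S j \<and> S j \<le> X j) \<and>
           (\<forall>r>0. (\<forall>j. r \<notin> {S j * exp (\<tau> j)..S j * exp (\<tau> (Suc j))}) \<longrightarrow>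
              (\<exists>v. (\<forall>k. B k * (r * exp (- \<tau> v)) ^ n k \<le> B v * (r * exp (- \<tau> v)) ^ n v) \<and>
                   (\<forall>N. S N * exp (\<tau> N) \<le> r \<longrightarrow> N < v)))"
  proof (rule normal_values[OF n B0])
    show "\<exists>k. B k \<noteq> 0" using nonzero by (auto simp: B_def)
    show "(\<lambda>k. B k * s ^ n k) \<longlonglongrightarrow> 0" if "0 < s" for s
    proof (rule tendsto_sandwich[of "\<lambda>_. 0" _ _ "\<lambda>k. cmod (a k * of_real (s * exp \<Delta>) ^ n k)"])
      show "(\<lambda>k. cmod (a k * of_real (s * exp \<Delta>) ^ n k)) \<longlonglongrightarrow> 0"
        by (intro tendsto_norm_zero summable_LIMSEQ_zero summ)
      have "B k * s ^ n k \<le> cmod (a k * of_real (s * exp \<Delta>) ^ n k)" for k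
      proof -
        have "B k * s ^ n k \<le> cmod (a k) * exp (\<Delta> * real (n k)) * s ^ n k"
          unfolding B_def using T_le[of k] that by (intro mult_right_mono mult_left_mono) auto
        also have "\<dots> = cmod (a k * of_real (s * exp \<Delta>) ^ n k)"
          using that by (simp add: norm_mult norm_power power_mult_distrib exp_of_nat2_mult)
        finally show ?thesis .
      qed
      then show "\<forall>\<^sub>F k in sequentially. B k * s ^ n k \<le> cmod (a k * of_real (s * exp \<Delta>) ^ n k)"
        by simp
    qed (use B0 that in auto)
    show "0 < X j" for j using b by (simp add: X_def less_max_iff_disj)
    show "overtaken B n j s" if "X j < s" for j s
    proof (rule ccontr)
      assume "\<not> overtaken B n j s"
      then obtain v where v: "v \<le> j" "\<And>k. B k * s ^ n k \<le> B v * s ^ n v"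
        using not_overtaken_dominates by blast
      define r where "r = s * exp (\<tau> v)"
      have s: "R < s" "real (n j) powr b < s" "0 < s" "s = r * exp (- \<tau> v)"
        using that b by (auto simp: X_def r_def exp_minus)
      have "s * 1 \<le> r" unfolding r_def using s \<tau>_nonneg by (intro mult_left_mono) auto
      then have r: "s \<le> r" by simp
      have "r \<le> real (n v) powr b"
        using r s dominant[of r v] v(2) by (intro central) auto
      also have "\<dots> \<le> real (n j) powr b"
        using v(1) b strict_mono_less_eq[OF n] by (intro powr_mono2) auto
      finally show False using r s by linarith
    qed
  qed (use \<tau>_inc \<tau>0 in auto)
  then obtain S where S: "\<And>j. 0 \<le> S j" "\<And>j. S j \<le> X j"
    and normal: "\<And>r. 0 < r \<Longrightarrow> (\<And>j. r \<notin> {S j * exp (\<tau> j)..S j * exp (\<tau> (Suc j))}) \<Longrightarrow>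
              (\<exists>v. (\<forall>k. B k * (r * exp (- \<tau> v)) ^ n k \<le> B v * (r * exp (- \<tau> v)) ^ n v) \<and>
                   (\<forall>N. S N * exp (\<tau> N) \<le> r \<longrightarrow> N < v))"
    by blast
  define L where "L j = S j * exp (\<tau> j)" for j
  define H where "H j = S j * exp (\<tau> (Suc j))" for j
  have L0: "0 \<le> L j" for j using S(1) by (simp add: L_def)
  have HL: "H j = L j * exp (\<delta> j)" for j by (simp add: H_def L_def \<tau>_Suc exp_add)
  have LH: "L j \<le> H j" for j
    using L0[of j] \<delta>[of j] by (simp add: HL mult_le_cancel_left1 less_imp_le)
  have H0: "0 \<le> H j" for j using L0[of j] LH[of j] by linarith
  have "\<forall>\<^sub>F j in sequentially. H j \<le> real (n j) powr (b + 1)"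
  proof -
    have "filterlim n at_top sequentially" by (rule filterlim_subseq[OF n])
    then have nlim: "filterlim (\<lambda>j. real (n j)) at_top sequentially"
      by (rule filterlim_compose[OF filterlim_real_sequentially])
    have "\<forall>\<^sub>F x in at_top. exp \<Delta> * R \<le> x powr (b + 1) \<and> exp \<Delta> * x powr b \<le> x powr (b + 1)"
    proof (intro eventually_conj)
      show "\<forall>\<^sub>F x in at_top. exp \<Delta> * R \<le> x powr (b + 1)" using b by real_asymp
      show "\<forall>\<^sub>F x in at_top. exp \<Delta> * x powr b \<le> x powr (b + 1)" using b by real_asymp
    qed
    then have "\<forall>\<^sub>F j in sequentially. exp \<Delta> * R \<le> real (n j) powr (b + 1) \<and>
        exp \<Delta> * real (n j) powr b \<le> real (n j) powr (b + 1)"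
      by (rule eventually_compose_filterlim[OF _ nlim])
    then show ?thesis
    proof eventually_elim
      case (elim j)
      have "H j \<le> X j * exp \<Delta>"
        unfolding H_def using S \<tau>_le b by (intro mult_mono) (auto simp: X_def le_max_iff_disj)
      also have "\<dots> \<le> real (n j) powr (b + 1)"
        using elim by (simp add: X_def max_def mult.commute)
      finally show ?case .
    qed
  qed
  then obtain j0 where j0: "\<And>j. j0 \<le> j \<Longrightarrow> H j \<le> real (n j) powr (b + 1)"
    by (auto simp: eventually_sequentially)
  define R0 where "R0 = max 1 (\<Sum>j<j0. H j)"
  have R0: "H j \<le> R0" if "j < j0" for j
  proof -
    have "H j \<le> (\<Sum>j<j0. H j)"
      using that H0 by (intro member_le_sum) auto
    then show ?thesis by (simp add: R0_def)
  qed
  define A where "A k = (case k of 0 \<Rightarrow> {1..R0} | Suc j \<Rightarrow> {L (j + j0)..H (j + j0)} \<inter> {1..})" for k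
  define E where "E = (\<Union>k. A k)"
  have A_borel: "A k \<in> sets borel" for k by (auto simp: A_def split: nat.split)
  have E_cover: "r \<notin> {L j..H j}" if "r \<notin> E" "R0 < r" for r j
  proof (cases "j < j0")
    case False
    have "r \<notin> A (Suc (j - j0))" using that by (auto simp: E_def)
    then show ?thesis using False that by (auto simp: A_def R0_def)
  qed (use R0[of j] that in auto)
  have finite_E: "h_log_measure h E < \<infinity>"
  proof -
    define w where "w k = (case k of 0 \<Rightarrow> half_line_deriv h R0 * (R0 - 1)
                                 | Suc j \<Rightarrow> exp \<Delta> * (\<delta> (j + j0) * y (j + j0)))" for k
    have w0: "0 \<le> w k" for k
      using L_plus_deriv_nonneg[OF h, of R0] \<delta> y
      by (auto simp: w_def R0_def less_imp_le split: nat.split)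
    have "summable (\<lambda>j. exp \<Delta> * (\<delta> (j + j0) * y (j + j0)))"
      by (intro summable_mult summable_ignore_initial_segment[OF sum_\<delta>y])
    then have sum_w: "summable w"
      by (subst summable_Suc_iff[symmetric]) (simp add: w_def)
    have A_le: "h_log_measure h (A k) \<le> ennreal (w k)" for k
    proof (cases k)
      case 0
      then show ?thesis
        using h_log_measure_Icc_le[OF h, of 1 R0] by (simp add: A_def w_def R0_def)
    next
      case (Suc i)
      define j where "j = i + j0"
      show ?thesis
      proof (cases "0 < L j")
        case True
        have "h_log_measure h (A k) \<le> h_log_measure h {L j..H j}"
          using Suc by (intro h_log_measure_mono) (auto simp: A_def j_def)
        also have "\<dots> \<le> ennreal (half_line_deriv h (H j) * (H j - L j) / L j)"
          using True LH by (intro h_log_measure_Icc_le h) auto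
        also have "half_line_deriv h (H j) * (H j - L j) / L j = half_line_deriv h (H j) * (exp (\<delta> j) - 1)"
          using True by (simp add: HL field_simps)
        also have "\<dots> \<le> y j * (exp \<Delta> * \<delta> j)"
        proof (intro mult_mono)
          show "half_line_deriv h (H j) \<le> y j"
            unfolding y_def using True LH[of j] j0[of j]
            by (intro L_plus_deriv_mono h) (auto simp: j_def)
          have "\<delta> j \<le> \<Delta>" using \<tau>_le[of "Suc j"] \<tau>_nonneg[of j] \<tau>_Suc[of j] by simp
          then have "\<delta> j * exp (\<delta> j) \<le> \<delta> j * exp \<Delta>"
            using \<delta>[of j] by (intro mult_left_mono) auto
          then show "exp (\<delta> j) - 1 \<le> exp \<Delta> * \<delta> j"
            using exp_minus_one_le[of "\<delta> j"] by (simp add: mult.commute)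
        qed (use y \<delta>[of j] in auto)
        also have "\<dots> = w k" using Suc by (simp add: w_def j_def)
        finally show ?thesis by (simp add: ennreal_leI)
      next
        case False
        \<comment> \<open>This happens when the coefficients up to \<open>j\<close> vanish; the interval is then the point \<open>0\<close>.\<close>
        then have "L j = 0" "H j = 0" using L0[of j] by (auto simp: HL)
        then have "A k = {}" using Suc by (simp add: A_def j_def)
        then show ?thesis by (simp add: h_log_measure_def)
      qed
    qed
    have "h_log_measure h E \<le> (\<Sum>k. h_log_measure h (A k))"
      unfolding E_def by (intro h_log_measure_UN_le A_borel)
    also have "\<dots> \<le> (\<Sum>k. ennreal (w k))" by (intro suminf_le A_le) auto
    also have "\<dots> < \<infinity>" using ennreal_suminf_neq_top[OF sum_w w0] by (simp add: less_top)
    finally show ?thesis .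
  qed
  have asymp: "\<forall>\<^sub>F r in at_top. r \<notin> E \<longrightarrow>
     0 < max_term a n r \<and> (\<forall>z\<in>sphere 0 r. \<bar>cmod (f z) - max_term a n r\<bar> \<le> \<epsilon> * max_term a n r)"
    if \<epsilon>: "0 < \<epsilon>" for \<epsilon>
  proof -
    have "(\<lambda>v. 3 * exp (1 - c v)) \<longlonglongrightarrow> 0"
    proof -
      have "((\<lambda>x::real. 3 * exp (1 - x)) \<longlongrightarrow> 0) at_top" by real_asymp
      then show ?thesis by (rule filterlim_compose[OF _ c(3)])
    qed
    then have "\<forall>\<^sub>F v in sequentially. 3 * exp (1 - c v) < \<epsilon>" using \<epsilon> by (rule order_tendstoD)
    then obtain N where N: "\<And>v. N \<le> v \<Longrightarrow> 3 * exp (1 - c v) < \<epsilon>"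
      by (auto simp: eventually_sequentially)
    show ?thesis
      using eventually_gt_at_top[of R0] eventually_ge_at_top[of "L N"]
    proof eventually_elim
      case (elim r)
      show ?case
      proof
        assume rE: "r \<notin> E"
        have r: "0 < r" using elim by (simp add: R0_def)
        obtain v where dom: "\<And>k. B k * (r * exp (- \<tau> v)) ^ n k \<le> B v * (r * exp (- \<tau> v)) ^ n v"
          and "N < v"
          using normal[OF r] E_cover[OF rE elim(1)] elim(2) unfolding L_def H_def by blast
        define m where "m = cmod (a v) * r ^ n v"
        have mt: "max_term a n r = m"
          unfolding max_term_def m_def
          by (rule cSup_eq_maximum) (use dominant[OF dom r] in auto)
        obtain i where "a i \<noteq> 0" using nonzero by blast
        then have "0 < cmod (a i) * r ^ n i" using r by simp
        also have "\<dots> \<le> m" unfolding m_def by (rule dominant[OF dom r])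
        finally have m: "0 < m" .
        have "\<bar>cmod (f z) - m\<bar> \<le> \<epsilon> * m" if "z \<in> sphere 0 r" for z
        proof -
          have z: "cmod z = r" using that by simp
          have "cmod (f z - a v * z ^ n v) \<le> 3 * (m * exp (1 - c (v - 1)))"
          proof (rule dominant_term_approximates[OF sums])
            fix k assume "k \<noteq> v"
            from separated[OF dom r this]
            show "cmod (a k) * cmod z ^ n k \<le> m * exp (1 - c (v - 1)) * (1/2) ^ ((k - v) + (v - k))"
              by (simp only: z m_def mult.assoc)
          qed (use m in auto)
          also have "\<dots> = m * (3 * exp (1 - c (v - 1)))" by simp
          also have "\<dots> \<le> m * \<epsilon>"
            using m less_imp_le[OF N[of "v - 1"]] \<open>N < v\<close> by (intro mult_left_mono) auto
          finally have "cmod (f z - a v * z ^ n v) \<le> \<epsilon> * m" by (simp add: mult.commute)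
          moreover have "cmod (a v * z ^ n v) = m" by (simp add: m_def norm_mult norm_power z)
          ultimately show ?thesis
            using norm_triangle_ineq3[of "f z" "a v * z ^ n v"] by linarith
        qed
        then show "0 < max_term a n r \<and>
          (\<forall>z\<in>sphere 0 r. \<bar>cmod (f z) - max_term a n r\<bar> \<le> \<epsilon> * max_term a n r)"
          using m mt by simp
      qed
    qed
  qed
  have "max_modulus f \<sim>[inf at_top (principal (- E))] max_term a n"
       "min_modulus f \<sim>[inf at_top (principal (- E))] max_term a n"
    using asymp_equiv_of_dominant_term[OF asymp] by auto
  then have "max_modulus f \<sim>[inf at_top (principal (- E))] min_modulus f"
            "max_modulus f \<sim>[inf at_top (principal (- E))] max_term a n"
    by (auto intro: asymp_equiv_trans[OF _ asymp_equiv_symI])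
  moreover have "E \<in> sets borel" unfolding E_def using A_borel by auto
  moreover have "E \<subseteq> {1..}" unfolding E_def A_def by (auto split: nat.splits)
  ultimately show ?thesis using finite_E by blast
qed

section \<open>Series with prescribed breakpoints\<close>

text \<open>Filling the missing exponents with zero coefficients gives an everywhere convergent power series.\<close>

lemma lacunary_series_holomorphic:
  fixes a :: "nat \<Rightarrow> complex"
  assumes n: "strict_mono n" and sums: "\<And>z. (\<lambda>k. a k * z ^ n k) sums f z"
  shows "f holomorphic_on UNIV"
proof -
  define c where "c m = (if m \<in> range n then a (inv n m) else 0)" for m
  have inj: "inj n" using n by (rule strict_mono_imp_inj_on)
  have "(\<lambda>m. c m * z ^ m) sums f z" for z
  proof (subst sums_mono_reindex[OF n, symmetric])
    show "(\<lambda>k. c (n k) * z ^ n k) sums f z"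
      using sums[of z] by (simp add: c_def inv_f_f[OF inj])
  qed (auto simp: c_def)
  then have "f = (\<lambda>z. \<Sum>m. c m * z ^ m)" and "summable (\<lambda>m. c m * z ^ m)" for z
    by (auto simp: sums_iff)
  then have "\<exists>D. (f has_field_derivative D) (at z)" for z
    using termdiffs_strong_converges_everywhere[of c z] by auto
  then show ?thesis by (auto simp: holomorphic_on_def field_differentiable_def)
qed

text \<open>Normalised by \<open>breakpoint_coeff \<rho> n 0 = 1\<close>, these are the coefficients for which the terms with indices
  \<open>j\<close> and \<open>Suc j\<close> agree at \<open>r = \<rho> j\<close>.\<close>

definition breakpoint_coeff :: "(nat \<Rightarrow> real) \<Rightarrow> (nat \<Rightarrow> nat) \<Rightarrow> nat \<Rightarrow> real" where
  "breakpoint_coeff \<rho> n k = (\<Prod>j<k. inverse (\<rho> j) ^ (n (Suc j) - n j))"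

context
  fixes n :: "nat \<Rightarrow> nat" and \<rho> :: "nat \<Rightarrow> real" and \<phi> :: "nat \<Rightarrow> real \<Rightarrow> real"
  assumes n: "strict_mono n" and \<rho>_inc: "incseq \<rho>" and \<rho>_ge: "1 \<le> \<rho> 0"
  defines "\<phi> \<equiv> (\<lambda>k r. breakpoint_coeff \<rho> n k * r ^ n k)"
begin

lemma breakpoint_pos: "0 < \<rho> k"
  using \<rho>_ge incseqD[OF \<rho>_inc, of 0 k] by simp

lemma breakpoint_term_pos: "0 < r \<Longrightarrow> 0 < \<phi> k r"
  using breakpoint_pos by (auto simp: \<phi>_def breakpoint_coeff_def intro!: mult_pos_pos prod_pos)

lemma breakpoint_term_Suc: "\<phi> (Suc k) r = \<phi> k r * (r / \<rho> k) ^ (n (Suc k) - n k)"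
proof -
  have "n k \<le> n (Suc k)" using strict_mono_less_eq[OF n] by simp
  then have "r ^ n (Suc k) = r ^ n k * r ^ (n (Suc k) - n k)" by (simp flip: power_add)
  then show ?thesis
    by (simp add: \<phi>_def breakpoint_coeff_def divide_inverse power_mult_distrib power_inverse)
qed

text \<open>Consecutive terms increase up to index \<open>Suc k\<close> and decrease from there on, because
  \<open>r / \<rho> j\<close> is at least \<open>1\<close> for \<open>j \<le> k\<close> and at most \<open>1\<close> for \<open>j > k\<close>.\<close>

lemma breakpoint_term_max:
  assumes "\<rho> k \<le> r" "r \<le> \<rho> (Suc k)"
  shows "\<phi> i r \<le> \<phi> (Suc k) r"
proof -
  have r: "0 < r" using assms breakpoint_pos[of k] by linarith
  have up: "\<phi> j r \<le> \<phi> (Suc j) r" if "j \<le> k" for j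
  proof -
    have "1 \<le> r / \<rho> j" using incseqD[OF \<rho>_inc that] assms breakpoint_pos[of j] by simp
    then show ?thesis
      unfolding breakpoint_term_Suc using breakpoint_term_pos[OF r, of j]
      by (simp add: mult_le_cancel_left1)
  qed
  have down: "\<phi> (Suc j) r \<le> \<phi> j r" if "k < j" for j
  proof -
    have "\<rho> (Suc k) \<le> \<rho> j" using that by (intro incseqD[OF \<rho>_inc]) auto
    then have "r / \<rho> j \<le> 1" "0 \<le> r / \<rho> j" using assms breakpoint_pos[of j] r by auto
    then show ?thesis
      unfolding breakpoint_term_Suc using breakpoint_term_pos[OF r, of j]
      by (simp add: mult_le_cancel_left2 power_le_one)
  qed
  show ?thesis
  proof (cases "i \<le> Suc k")
    case True
    then show ?thesis
    proof (induction rule: inc_induct)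
      case (step j) then show ?case using up[of j] by simp
    qed simp
  next
    case False
    then have "Suc k \<le> i" by simp
    then show ?thesis
    proof (induction rule: dec_induct)
      case (step j) then show ?case using down[of j] by simp
    qed simp
  qed
qed

lemma breakpoint_term_near_max:
  assumes "\<rho> k \<le> r" "r \<le> \<rho> k * exp (1 / (real (n (Suc k)) - real (n k)))"
  shows "exp (- 1) * \<phi> (Suc k) r \<le> \<phi> k r"
proof -
  define g where "g = n (Suc k) - n k"
  have g: "0 < g" "real (n (Suc k)) - real (n k) = real g"
    using n by (simp_all add: g_def strict_mono_Suc_iff less_imp_le of_nat_diff)
  have r: "0 < r" using assms breakpoint_pos[of k] by linarith
  have "(r / \<rho> k) ^ g \<le> exp (1 / real g) ^ g"
    using assms r breakpoint_pos[of k] by (intro power_mono) (auto simp: g(2) field_simps)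
  also have "\<dots> = exp 1" using g by (simp add: exp_of_nat_mult[symmetric])
  finally have "\<phi> (Suc k) r \<le> \<phi> k r * exp 1"
    unfolding breakpoint_term_Suc g_def
    using breakpoint_term_pos[OF r, of k] by (intro mult_left_mono) auto
  then show ?thesis by (simp add: exp_minus field_simps)
qed

text \<open>As long as \<open>r\<close> exceeds the earlier breakpoints by the factor \<open>exp 1\<close>, every unit of the exponent gains
  this factor.\<close>

lemma breakpoint_term_growth:
  assumes "\<And>i. i < j \<Longrightarrow> \<rho> i \<le> r / exp 1" "1 \<le> r"
  shows "exp (real (n j) - real (n 0)) \<le> \<phi> j r"
  using assms(1)
proof (induction j)
  case 0
  then show ?case using assms(2) by (simp add: \<phi>_def breakpoint_coeff_def)
next
  case (Suc j)
  define g where "g = n (Suc j) - n j"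
  have g: "real (n (Suc j)) = real (n j) + real g"
    using n by (simp add: g_def strict_mono_Suc_iff less_imp_le of_nat_diff)
  have "exp 1 \<le> r / \<rho> j" using Suc.prems[of j] breakpoint_pos[of j] by (simp add: field_simps)
  then have "exp 1 ^ g \<le> (r / \<rho> j) ^ g" by (intro power_mono) auto
  moreover have "exp (real (n j) - real (n 0)) \<le> \<phi> j r" using Suc by simp
  ultimately have "exp (real (n j) - real (n 0)) * exp 1 ^ g \<le> \<phi> (Suc j) r"
    unfolding breakpoint_term_Suc g_def[symmetric]
    using breakpoint_term_pos[of r j] assms(2) by (intro mult_mono) auto
  then show ?case by (simp add: g exp_of_nat_mult[symmetric] exp_add[symmetric] algebra_simps)
qed

lemma breakpoint_terms_summable:
  assumes "filterlim \<rho> at_top sequentially" "0 \<le> r"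
  shows "summable (\<lambda>k. \<phi> k r)"
proof -
  obtain N where N: "\<And>k. N \<le> k \<Longrightarrow> 2 * r \<le> \<rho> k"
    using assms(1) by (auto simp: filterlim_at_top eventually_sequentially)
  have nonneg: "0 \<le> \<phi> k r" for k
    using breakpoint_pos assms(2)
    by (auto simp: \<phi>_def breakpoint_coeff_def less_imp_le intro!: mult_nonneg_nonneg prod_nonneg)
  show ?thesis
  proof (rule summable_ratio_test[of "1/2" N])
    fix k assume "N \<le> k"
    then have le: "r / \<rho> k \<le> 1 / 2" "0 \<le> r / \<rho> k"
      using N[of k] breakpoint_pos[of k] assms(2) by (auto simp: field_simps)
    have "1 \<le> n (Suc k) - n k" using n by (simp add: strict_mono_Suc_iff Suc_leI)
    then have "(r / \<rho> k) ^ (n (Suc k) - n k) \<le> (r / \<rho> k) ^ 1"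
      using le(1) by (intro power_decreasing le(2)) linarith+
    then have "(r / \<rho> k) ^ (n (Suc k) - n k) \<le> 1 / 2"
      using le(1) unfolding power_one_right by linarith
    then have "\<phi> k r * (r / \<rho> k) ^ (n (Suc k) - n k) \<le> \<phi> k r * (1 / 2)"
      using nonneg by (intro mult_left_mono)
    then show "norm (\<phi> (Suc k) r) \<le> 1 / 2 * norm (\<phi> k r)"
      using nonneg[of k] nonneg[of "Suc k"] by (simp add: breakpoint_term_Suc)
  qed simp
qed

text \<open>Right after \<open>\<rho> k\<close> the term \<open>Suc k\<close> is maximal and the term \<open>k\<close> is at least \<open>exp (- 1)\<close> times as large;
  positive coefficients make the two add up at the point \<open>r\<close> of the circle. For the lower order, let
  \<open>\<rho> j\<close> be the first breakpoint beyond \<open>r / exp 1\<close>: the \<open>j\<close>-th term is at least \<open>exp (n j - n 0)\<close>, and the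
  bound on \<open>\<rho> j\<close> forces \<open>n j\<close> to be at least of the order of \<open>r powr (1 / \<beta>)\<close>. Using the index \<open>j\<close> beyond
  the jump, not the one before it, makes the size of the gap irrelevant.\<close>

lemma breakpoint_series:
  assumes lim: "filterlim \<rho> at_top sequentially"
    and C: "0 < C" "0 < \<beta>" "\<And>k. \<rho> k \<le> C * (real (n k) + 1) powr \<beta>"
  shows "\<exists>f\<in>entire_pos_lower_order. \<exists>a. (\<forall>z. (\<lambda>k. a k * z ^ n k) sums f z) \<and>
           (\<forall>r>0. 0 < max_term a n r) \<and>
           (\<forall>k r. \<rho> k \<le> r \<longrightarrow> r \<le> \<rho> (Suc k) \<longrightarrow>
              r \<le> \<rho> k * exp (1 / (real (n (Suc k)) - real (n k))) \<longrightarrow>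
              (1 + exp (- 1)) * max_term a n r \<le> max_modulus f r)"
proof -
  define a :: "nat \<Rightarrow> complex" where "a k = of_real (breakpoint_coeff \<rho> n k)" for k
  define f where "f z = (\<Sum>k. a k * z ^ n k)" for z
  have coeff_pos: "0 < breakpoint_coeff \<rho> n k" for k
    using breakpoint_pos by (auto simp: breakpoint_coeff_def intro!: prod_pos)
  have term_eq: "cmod (a k) * r ^ n k = \<phi> k r" for k r
    using coeff_pos[of k] by (simp add: a_def \<phi>_def)
  have sums: "(\<lambda>k. a k * z ^ n k) sums f z" for z
    unfolding f_def
  proof (rule summable_sums, rule summable_norm_cancel)
    show "summable (\<lambda>k. norm (a k * z ^ n k))"
      using breakpoint_terms_summable[OF lim, of "cmod z"]
      by (simp add: norm_mult norm_power term_eq)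
  qed
  then have holf: "f holomorphic_on UNIV" by (rule lacunary_series_holomorphic[OF n])
  have partial: "(\<Sum>k\<in>I. \<phi> k r) \<le> max_modulus f r" if "finite I" "0 < r" for I r
  proof -
    have "(\<Sum>k\<in>I. \<phi> k r) \<le> (\<Sum>k. \<phi> k r)"
      using that breakpoint_term_pos[of r]
      by (intro sum_le_suminf breakpoint_terms_summable[OF lim]) (auto simp: less_imp_le)
    also have "\<dots> \<le> cmod (f (of_real r))"
    proof -
      have "(\<lambda>k. of_real (\<phi> k r)) sums (of_real (\<Sum>k. \<phi> k r) :: complex)"
        using that by (intro sums_of_real summable_sums breakpoint_terms_summable[OF lim]) auto
      moreover have "of_real (\<phi> k r) = a k * of_real r ^ n k" for k
        by (simp add: a_def \<phi>_def)
      ultimately have "f (of_real r) = of_real (\<Sum>k. \<phi> k r)"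
        using sums_unique2[OF sums] by simp
      then show ?thesis by simp
    qed
    also have "\<dots> \<le> max_modulus f r"
      using that by (intro norm_le_max_modulus[OF holf]) auto
    finally show ?thesis .
  qed
  have lower: "f \<in> entire_pos_lower_order"
  proof -
    define p where "p = 1 / \<beta>"
    have p: "0 < p" using C by (simp add: p_def)
    have "\<forall>\<^sub>F r in at_top. r powr (p / 2) \<le> (r / (exp 1 * C)) powr p - (1 + real (n 0))"
      using p C(1) by real_asymp
    then have "\<forall>\<^sub>F r in at_top. p / 2 \<le> ln (ln (max_modulus f r)) / ln r"
      using eventually_ge_at_top[of "exp 1 * \<rho> 0"] eventually_gt_at_top[of 1]
    proof eventually_elim
      case (elim r)
      obtain i where "r / exp 1 < \<rho> i"
        using lim by (auto simp: filterlim_at_top_dense eventually_sequentially)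
      define j where "j = (LEAST j. r / exp 1 < \<rho> j)"
      have j: "r / exp 1 < \<rho> j" unfolding j_def using \<open>r / exp 1 < \<rho> i\<close> by (rule LeastI)
      have "\<rho> i \<le> r / exp 1" if "i < j" for i
        using not_less_Least[of i "\<lambda>j. r / exp 1 < \<rho> j"] that by (simp add: j_def not_less)
      then have "exp (real (n j) - real (n 0)) \<le> \<phi> j r"
        using elim by (intro breakpoint_term_growth) auto
      also have "\<dots> \<le> max_modulus f r" using partial[of "{j}" r] elim by simp
      finally have M: "exp (real (n j) - real (n 0)) \<le> max_modulus f r" .
      then have Mpos: "0 < max_modulus f r" by (meson exp_gt_zero less_le_trans)
      have "r / exp 1 \<le> C * (real (n j) + 1) powr \<beta>" using j C(3)[of j] by linarith
      then have "r / (exp 1 * C) \<le> (real (n j) + 1) powr \<beta>" using C(1) by (simp add: field_simps)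
      then have "(r / (exp 1 * C)) powr p \<le> ((real (n j) + 1) powr \<beta>) powr p"
        using p C elim by (intro powr_mono2) auto
      also have "\<dots> = real (n j) + 1" using C by (simp add: powr_powr p_def)
      finally have "r powr (p / 2) \<le> real (n j) - real (n 0)" using elim by linarith
      also have "\<dots> \<le> ln (max_modulus f r)" using M Mpos by (simp add: ln_ge_iff)
      finally have "ln (r powr (p / 2)) \<le> ln (ln (max_modulus f r))"
        using elim by (subst ln_le_cancel_iff) (auto intro: less_le_trans[of _ "r powr (p / 2)"])
      then show ?case using elim by (simp add: ln_powr field_simps)
    qed
    then have "ereal (p / 2) \<le> lower_order f"
      unfolding lower_order_def by (intro Liminf_bounded) simp
    moreover have "0 < ereal (p / 2)" using p by simp
    ultimately have "0 < lower_order f" by order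
    then show ?thesis using holf by (simp add: entire_pos_lower_order_def)
  qed
  have "(1 + exp (- 1)) * max_term a n r \<le> max_modulus f r"
    if "\<rho> k \<le> r" "r \<le> \<rho> (Suc k)" "r \<le> \<rho> k * exp (1 / (real (n (Suc k)) - real (n k)))" for k r
  proof -
    have "max_term a n r = \<phi> (Suc k) r"
      unfolding max_term_def term_eq
      by (rule cSup_eq_maximum) (use breakpoint_term_max[OF that(1,2)] in auto)
    then have "(1 + exp (- 1)) * max_term a n r \<le> (\<Sum>i\<in>{k, Suc k}. \<phi> i r)"
      using breakpoint_term_near_max[OF that(1,3)] by (simp add: algebra_simps)
    also have "\<dots> \<le> max_modulus f r"
      using that breakpoint_pos[of k] by (intro partial) auto
    finally show ?thesis .
  qed
  moreover have "0 < max_term a n r" if "0 < r" for r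
  proof -
    have "0 < \<phi> 0 r" using breakpoint_term_pos[OF that] .
    also have "\<dots> \<le> max_term a n r"
      unfolding max_term_def term_eq[symmetric]
      using that sums by (intro cSUP_upper max_term_bdd) (auto simp: sums_iff)
    finally show ?thesis .
  qed
  ultimately show ?thesis using lower sums by blast
qed

end


section \<open>Divergence produces a counterexample\<close>

lemma asymp_equiv_excludes_excess:
  fixes F G :: "real \<Rightarrow> real"
  assumes "F \<sim>[inf at_top (principal (- E))] G" "1 < q"
  shows "\<exists>R. \<forall>r>R. 0 < G r \<longrightarrow> q * G r \<le> F r \<longrightarrow> r \<in> E"
proof -
  have "\<forall>\<^sub>F r in inf at_top (principal (- E)). (if F r = 0 \<and> G r = 0 then 1 else F r / G r) < q"
    using asymp_equivD[OF assms(1)] assms(2) by (rule order_tendstoD)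
  then obtain R where R: "\<And>r. R \<le> r \<Longrightarrow> r \<notin> E \<Longrightarrow> (if F r = 0 \<and> G r = 0 then 1 else F r / G r) < q"
    by (auto simp: eventually_inf_principal eventually_at_top_linorder)
  show ?thesis
  proof (intro exI[of _ R] allI impI)
    fix r assume r: "R < r" "0 < G r" "q * G r \<le> F r"
    show "r \<in> E"
    proof (rule ccontr)
      assume "r \<notin> E"
      then have "F r / G r < q" using R[of r] r by auto
      then show False using r by (simp add: field_simps)
    qed
  qed
qed

lemma half_le_one_minus_exp:
  assumes "0 \<le> x" "x \<le> 1"
  shows "x / 2 \<le> 1 - exp (- x :: real)"
proof -
  have "1 \<le> (1 - x / 2) * (1 + x)"
    using mult_left_mono[OF assms(2,1)] by (simp add: algebra_simps)
  then have "exp (- x) \<le> ((1 - x / 2) * (1 + x)) * exp (- x)"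
    by (simp add: mult_le_cancel_right1)
  also have "\<dots> \<le> ((1 - x / 2) * exp x) * exp (- x)"
    using assms exp_ge_add_one_self[of x] by (intro mult_right_mono mult_left_mono) auto
  also have "\<dots> = 1 - x / 2" by (simp add: exp_minus)
  finally show ?thesis by simp
qed

lemma divergence_counterexample:
  assumes h: "h \<in> L_plus" and n: "strict_mono n" and b: "0 < b"
    and div: "\<not> summable (\<lambda>k. 1 / (real (n (Suc k)) - real (n k)) *
                                half_line_deriv h (real (n k) powr b))"
  shows "\<exists>f\<in>entire_pos_lower_order. \<exists>a. (\<forall>z. (\<lambda>k. a k * z ^ n k) sums f z) \<and>
           (\<forall>E. max_modulus f \<sim>[inf at_top (principal (- E))] max_term a n \<longrightarrow>
                h_log_measure h E = \<infinity>)"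
proof -
  define g where "g j = real (n (Suc j)) - real (n j)" for j
  have g: "1 \<le> g j" for j
  proof -
    have "Suc (n j) \<le> n (Suc j)" using n by (simp add: strict_mono_Suc_iff Suc_leI)
    then show ?thesis unfolding g_def by linarith
  qed
  have g0: "0 < g j" for j using g[of j] by simp
  define \<sigma> where "\<sigma> k = (\<Sum>j<k. 1 / g j)" for k
  have \<sigma>_Suc: "\<sigma> (Suc k) = \<sigma> k + 1 / g k" for k by (simp add: \<sigma>_def)
  have \<sigma>_inc: "incseq \<sigma>" using g0 by (intro incseq_SucI) (simp add: \<sigma>_Suc less_imp_le)
  have \<sigma>0: "\<sigma> 0 = 0" by (simp add: \<sigma>_def)
  have \<sigma>_nonneg: "0 \<le> \<sigma> k" for k using incseqD[OF \<sigma>_inc, of 0 k] \<sigma>0 by simp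
  have n_ge: "k \<le> n k" for k using strict_mono_imp_increasing[OF n] .
  have n_lim: "filterlim (\<lambda>k. real (n k)) at_top sequentially"
    by (rule filterlim_compose[OF filterlim_real_sequentially filterlim_subseq[OF n]])
  show ?thesis
  proof (cases "summable (\<lambda>j. 1 / g j)")
    case False
    \<comment> \<open>The step from \<open>\<rho> k\<close> to \<open>\<rho> (Suc k)\<close> is at most \<open>\<rho> k / g k\<close>, so no radius from \<open>1\<close> on is left out, while
      \<open>\<rho> k \<le> 1 + k\<close> keeps the lower order positive.\<close>
    define \<rho> where "\<rho> k = 1 + \<sigma> k" for k
    have \<rho>_inc: "incseq \<rho>" using \<sigma>_inc by (simp add: \<rho>_def incseq_def)
    have \<rho>_lim: "filterlim \<rho> at_top sequentially"
    proof -
      have "\<not> (\<exists>B. \<forall>k. \<sigma> k \<le> B)"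
      proof
        assume "\<exists>B. \<forall>k. \<sigma> k \<le> B"
        then obtain B where "\<And>k. \<sigma> k \<le> B" by blast
        then have "summable (\<lambda>j. 1 / g j)"
          using g0 unfolding \<sigma>_def by (intro summableI_nonneg_bounded[of _ B]) (auto simp: less_imp_le)
        with False show False ..
      qed
      then have "filterlim \<sigma> at_top sequentially"
        using \<sigma>_inc
        by (auto simp: filterlim_at_top eventually_sequentially not_le incseq_def) (meson le_less_trans less_imp_le order_trans)
      then show ?thesis unfolding \<rho>_def by (rule filterlim_tendsto_add_at_top[OF tendsto_const])
    qed
    have \<rho>_le: "\<rho> k \<le> 1 * (real (n k) + 1) powr 1" for k
    proof -
      have "\<sigma> k \<le> real k"
        unfolding \<sigma>_def using sum_mono[of "{..<k}" "\<lambda>j. 1 / g j" "\<lambda>_. 1"] g g0 by simp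
      then show ?thesis using n_ge[of k] by (simp add: \<rho>_def)
    qed
    obtain f a where f: "f \<in> entire_pos_lower_order" "\<And>z. (\<lambda>k. a k * z ^ n k) sums f z"
      "\<And>r. 0 < r \<Longrightarrow> 0 < max_term a n r"
      "\<And>k r. \<rho> k \<le> r \<Longrightarrow> r \<le> \<rho> (Suc k) \<Longrightarrow>
              r \<le> \<rho> k * exp (1 / (real (n (Suc k)) - real (n k))) \<Longrightarrow>
              (1 + exp (- 1)) * max_term a n r \<le> max_modulus f r"
      using breakpoint_series[OF n \<rho>_inc _ \<rho>_lim _ _ \<rho>_le] by (auto simp: \<rho>_def \<sigma>0)
    have all: "(1 + exp (- 1)) * max_term a n r \<le> max_modulus f r" if "1 \<le> r" for r
    proof -
      obtain i where "r < \<rho> i"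
        using \<rho>_lim by (auto simp: filterlim_at_top_dense eventually_sequentially)
      define j where "j = (LEAST j. r < \<rho> j)"
      have j: "r < \<rho> j" unfolding j_def using \<open>r < \<rho> i\<close> by (rule LeastI)
      with that obtain k where k: "j = Suc k" by (cases j) (auto simp: \<rho>_def \<sigma>0)
      have lo: "\<rho> k \<le> r"
        using not_less_Least[of k "\<lambda>j. r < \<rho> j"] k by (simp add: j_def not_less)
      have "\<rho> (Suc k) = \<rho> k + 1 * (1 / g k)" by (simp add: \<rho>_def \<sigma>_Suc)
      also have "\<dots> \<le> \<rho> k + \<rho> k * (1 / g k)"
        using g0[of k] \<sigma>_nonneg[of k] by (intro add_left_mono mult_right_mono) (auto simp: \<rho>_def)
      also have "\<dots> = \<rho> k * (1 + 1 / g k)" by (simp add: algebra_simps)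
      also have "\<dots> \<le> \<rho> k * exp (1 / g k)"
        using \<sigma>_nonneg[of k] by (intro mult_left_mono exp_ge_add_one_self) (auto simp: \<rho>_def)
      finally show ?thesis using lo j k by (intro f(4)[of k]) (auto simp: g_def)
    qed
    have "h_log_measure h E = \<infinity>"
      if asym: "max_modulus f \<sim>[inf at_top (principal (- E))] max_term a n" for E
    proof -
      obtain R where R: "\<And>r. R < r \<Longrightarrow> 0 < max_term a n r \<Longrightarrow>
          (1 + exp (- 1)) * max_term a n r \<le> max_modulus f r \<Longrightarrow> r \<in> E"
        using asymp_equiv_excludes_excess[OF asym, of "1 + exp (- 1)"] by auto
      have "{max R 1<..} \<subseteq> E"
        using R all f(3) by auto
      then show ?thesis
        using h_log_measure_mono[of "{max R 1<..}" E h] h_log_measure_Ioi_infinite[OF h, of "max R 1"]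
        by (simp add: top_unique)
    qed
    with f show ?thesis by blast
  next
    case True
    \<comment> \<open>The factor \<open>exp (\<sigma> k)\<close> makes room for the intervals \<open>(\<rho> k, y k]\<close> to be disjoint even where \<open>n\<close> has
      clusters.\<close>
    define \<Sigma> where "\<Sigma> = (\<Sum>j. 1 / g j)"
    have \<sigma>_le: "\<sigma> k \<le> \<Sigma>" for k
      unfolding \<sigma>_def \<Sigma>_def using g0 by (intro sum_le_suminf True) (auto simp: less_imp_le)
    define \<rho> where "\<rho> k = (real (n k) + 1) powr b * exp (\<sigma> k)" for k
    define y where "y k = \<rho> k * exp (1 / g k)" for k
    have y_le: "y k \<le> \<rho> (Suc k)" for k
    proof -
      have "y k = (real (n k) + 1) powr b * exp (\<sigma> (Suc k))"
        by (simp add: y_def \<rho>_def \<sigma>_Suc exp_add)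
      also have "\<dots> \<le> \<rho> (Suc k)"
        unfolding \<rho>_def using b strict_mono_less_eq[OF n, of k "Suc k"]
        by (intro mult_right_mono powr_mono2) auto
      finally show ?thesis .
    qed
    have \<rho>_pos: "0 < \<rho> k" for k by (simp add: \<rho>_def)
    have le_y: "\<rho> k \<le> y k" for k
      unfolding y_def using \<rho>_pos[of k] g0[of k] by (simp add: mult_le_cancel_left1)
    have \<rho>_inc: "incseq \<rho>"
      using le_y y_le by (intro incseq_SucI) (rule order_trans)
    have \<rho>_ge: "real (n k) powr b \<le> \<rho> k" for k
    proof -
      have "real (n k) powr b * 1 \<le> \<rho> k"
        unfolding \<rho>_def using b \<sigma>_nonneg[of k] by (intro mult_mono powr_mono2) auto
      then show ?thesis by simp
    qed
    have \<rho>_lim: "filterlim \<rho> at_top sequentially"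
    proof (rule filterlim_at_top_mono)
      have "filterlim (\<lambda>x::real. x powr b) at_top at_top" using b by real_asymp
      then show "filterlim (\<lambda>k. real (n k) powr b) at_top sequentially"
        by (rule filterlim_compose[OF _ n_lim])
    qed (use \<rho>_ge in simp)
    have \<rho>_le: "\<rho> k \<le> exp \<Sigma> * (real (n k) + 1) powr b" for k
      unfolding \<rho>_def using \<sigma>_le[of k] by (simp add: mult.commute mult_right_mono)
    have \<rho>0: "1 \<le> \<rho> 0"
      unfolding \<rho>_def \<sigma>0 using b by (simp add: ge_one_powr_ge_zero)
    obtain f a where f: "f \<in> entire_pos_lower_order" "\<And>z. (\<lambda>k. a k * z ^ n k) sums f z"
      "\<And>r. 0 < r \<Longrightarrow> 0 < max_term a n r"
      "\<And>k r. \<rho> k \<le> r \<Longrightarrow> r \<le> \<rho> (Suc k) \<Longrightarrow>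
              r \<le> \<rho> k * exp (1 / (real (n (Suc k)) - real (n k))) \<Longrightarrow>
              (1 + exp (- 1)) * max_term a n r \<le> max_modulus f r"
      using breakpoint_series[OF n \<rho>_inc \<rho>0 \<rho>_lim _ b \<rho>_le] by auto
    have "h_log_measure h E = \<infinity>"
      if asym: "max_modulus f \<sim>[inf at_top (principal (- E))] max_term a n" for E
    proof -
      obtain R where R: "\<And>r. R < r \<Longrightarrow> 0 < max_term a n r \<Longrightarrow>
          (1 + exp (- 1)) * max_term a n r \<le> max_modulus f r \<Longrightarrow> r \<in> E"
        using asymp_equiv_excludes_excess[OF asym, of "1 + exp (- 1)"] by auto
      obtain N where N: "\<And>k. N \<le> k \<Longrightarrow> R \<le> \<rho> k"
        using \<rho>_lim by (auto simp: filterlim_at_top eventually_sequentially)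
      have "{\<rho> (k + N)<..y (k + N)} \<subseteq> E" for k
      proof
        fix r assume r: "r \<in> {\<rho> (k + N)<..y (k + N)}"
        show "r \<in> E"
        proof (rule R)
          show "R < r" using r N[of "k + N"] by simp
          show "0 < max_term a n r" using r \<rho>_pos[of "k + N"] by (intro f(3)) auto
          show "(1 + exp (- 1)) * max_term a n r \<le> max_modulus f r"
            using r y_le[of "k + N"] by (intro f(4)[of "k + N"]) (auto simp: y_def g_def)
        qed
      qed
      then have sub: "(\<Union>k. {\<rho> (k + N)<..y (k + N)}) \<subseteq> E" by blast
      have "h_log_measure h (\<Union>k. {\<rho> (k + N)<..y (k + N)}) = \<infinity>"
      proof (rule h_log_measure_chain_infinite[OF h])
        show "\<not> summable (\<lambda>k. half_line_deriv h (\<rho> (k + N)) * (1 - \<rho> (k + N) / y (k + N)))"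
        proof
          assume "summable (\<lambda>k. half_line_deriv h (\<rho> (k + N)) * (1 - \<rho> (k + N) / y (k + N)))"
          then have sm: "summable (\<lambda>k. 2 * (half_line_deriv h (\<rho> k) * (1 - \<rho> k / y k)))"
            using summable_iff_shift[of "\<lambda>k. half_line_deriv h (\<rho> k) * (1 - \<rho> k / y k)" N]
            by (intro summable_mult) simp
          have "summable (\<lambda>k. 1 / g k * half_line_deriv h (real (n k) powr b))"
          proof (rule summable_comparison_test'[OF sm])
            fix k :: nat
            have x: "0 < 1 / g k" "1 / g k \<le> 1" using g[of k] by auto
            have "1 / g k \<le> 2 * (1 - exp (- (1 / g k)))"
              using half_le_one_minus_exp[of "1 / g k"] x by simp
            moreover have "\<rho> k / y k = exp (- (1 / g k))"
              using \<rho>_pos[of k] by (simp add: y_def exp_minus field_simps)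
            ultimately have le: "1 / g k \<le> 2 * (1 - \<rho> k / y k)" by simp
            have h0: "0 \<le> half_line_deriv h (real (n k) powr b)"
              by (intro L_plus_deriv_nonneg h) auto
            have "half_line_deriv h (real (n k) powr b) \<le> half_line_deriv h (\<rho> k)"
              using \<rho>_ge by (intro L_plus_deriv_mono h) auto
            then have "1 / g k * half_line_deriv h (real (n k) powr b)
                \<le> 2 * (1 - \<rho> k / y k) * half_line_deriv h (\<rho> k)"
              using le x h0 by (intro mult_mono) linarith+
            then show "norm (1 / g k * half_line_deriv h (real (n k) powr b))
                \<le> 2 * (half_line_deriv h (\<rho> k) * (1 - \<rho> k / y k))"
              using h0 x by (simp add: algebra_simps)
          qed
          with div show False by (simp add: g_def)
        qed
      qed (use \<rho>_pos le_y y_le in auto)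
      then show ?thesis
        using h_log_measure_mono[OF sub, of h] by (simp add: top_unique)
    qed
    with f show ?thesis by blast
  qed
qed

theorem corollary4p3:
  fixes h :: "real \<Rightarrow> real" and n :: "nat \<Rightarrow> nat"
  assumes "h \<in> L_plus" and "strict_mono n"
  shows "(\<forall>f \<in> entire_pos_lower_order. \<forall>a :: nat \<Rightarrow> complex.
            (\<forall>z. (\<lambda>k. a k * z ^ n k) sums f z) \<longrightarrow>
            (\<exists>E \<in> sets borel. E \<subseteq> {1..} \<and> h_log_measure h E < \<infinity> \<and>
               max_modulus f \<sim>[inf at_top (principal (- E))] min_modulus f \<and>
               max_modulus f \<sim>[inf at_top (principal (- E))] max_term a n))
     \<longleftrightarrow>
         (\<forall>b>0. summable (\<lambda>k. 1 / (real (n (Suc k)) - real (n k)) *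
                                half_line_deriv h (real (n k) powr b)))"
    (is "?lhs \<longleftrightarrow> ?rhs")
proof
  assume rel: ?lhs
  show ?rhs
  proof (intro allI impI, rule ccontr)
    fix b :: real
    assume "0 < b" and "\<not> summable (\<lambda>k. 1 / (real (n (Suc k)) - real (n k)) *
                                half_line_deriv h (real (n k) powr b))"
    then obtain f a where f: "f \<in> entire_pos_lower_order"
      and sums: "\<forall>z. (\<lambda>k. a k * z ^ n k) sums f z"
      and inf: "\<And>E. max_modulus f \<sim>[inf at_top (principal (- E))] max_term a n
                  \<Longrightarrow> h_log_measure h E = \<infinity>"
      using divergence_counterexample[OF assms, of b] by auto
    obtain E where "h_log_measure h E < \<infinity>"
      "max_modulus f \<sim>[inf at_top (principal (- E))] max_term a n"
      using rel[THEN bspec, OF f, THEN spec, THEN mp, OF sums] by (elim bexE conjE) rule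
    with inf[of E] show False by simp
  qed
next
  assume ?rhs
  then show ?lhs
    by (intro ballI allI impI, intro relation_off_exceptional_set[OF assms]) simp_all
qed

end
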